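(* Let $q$ be an odd prime power, and let $\mathcal{S}$ be a set of $q^2+1$ pairwise noncollinear points of $\mathsf{H}(3,q^2)$ such that the following hold: (i) There is a point $P\in\mathcal{S}$ and a totally isotropic line $\ell$ through $P$ such that every point of $\mathsf{H}(3,q^2)$ incident with $\ell$ and not equal to $P$ is collinear with a unique element of $\mathcal{S}\setminus\{P\}$. This yields a natural correspondence $F_\ell$ from $\ell$ to $\mathcal{S}$: $F_\ell(P)=P$, and for $Y\in\ell\setminus\{P\}$, $F_\ell(Y)$ is the unique point of $\mathcal{S}\setminus\{P\}$ collinear with $Y$. (ii) Every Baer subline $b$ of $\ell$ containing $P$ maps under $F_\ell$ to $q+1$ points of a plane of $\mathrm{PG}(3,q^2)$ incident with $P$. (iii) There is a point $Q\in\mathcal{S}$, $Q\neq P$, such that for every $R\neq P,Q$ in $\mathcal{S}$, the triangle $PQR$ is in perspective. (iv) The plane spanned by any three distinct points $R_1,R_2,R_3\in\mathcal{S}$ is nondegenerate. Then $\mathcal{S}$ is equivalent under the collineation group of $\mathsf{H}(3,q^2)$ to the Hermitian Veronesean $\mathcal{V}$.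
   Context: Points of $\mathrm{PG}(3,q^2)$ are given by homogeneous coordinates $(X_0,X_1,X_2,X_3)$ over $\mathbb{F}_{q^2}$. Let $h(X,Y)=X_0Y_3^q+X_3Y_0^q-X_1Y_1^q-X_2Y_2^q$, and let $\mathsf{H}(3,q^2)$ be the associated Hermitian surface, i.e. the set of points $X$ with $h(X,X)=0$. Two points $X,Y$ of $\mathsf{H}(3,q^2)$ are called collinear if $h(X,Y)=0$ (for distinct points: the line $XY$ is contained in $\mathsf{H}(3,q^2)$); "pairwise noncollinear" means no two distinct points are collinear. A line is totally isotropic if it is contained in $\mathsf{H}(3,q^2)$. Let $\perp$ be the polarity of $\mathrm{PG}(3,q^2)$ defined by $h$. A plane is degenerate if the restriction of $h$ to it is degenerate (equivalently it equals $Z^\perp$ for some point $Z$ of $\mathsf{H}(3,q^2)$), and nondegenerate otherwise. A Baer subline of a line of $\mathrm{PG}(3,q^2)$ is a set of $q+1$ points of the form $\{\langle \lambda u+\mu v\rangle:(\lambda,\mu)\in\mathbb{F}_q^2\setminus\{(0,0)\}\}$, where $u,v$ are linearly independent vectors spanning the line. Three pairwise noncollinear points $A,B,C$ of $\mathsf{H}(3,q^2)$ are in perspective (the triangle $ABC$ is in perspective) if the planes $\langle A^\perp\cap B^\perp,C\rangle$, $\langle B^\perp\cap C^\perp,A\rangle$, $\langle C^\perp\cap A^\perp,B\rangle$ intersect in a line. The collineation group of $\mathsf{H}(3,q^2)$ is $\mathrm{P\Gamma U}(4,q)$, the group of all collineations of $\mathrm{PG}(3,q^2)$ (induced by semilinear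 maps) that stabilise $\mathsf{H}(3,q^2)$. The Hermitian Veronesean is $\mathcal{V}=\{(1,x,x^q,x^{q+1}):x\in\mathbb{F}_{q^2}\}\cup\{(0,0,0,1)\}$. *)

theory Defs
  imports "HOL-Analysis.Analysis" "HOL-Number_Theory.Prime_Powers"
begin

text \<open>
  The field of order \<open>q\<^sup>2\<close> is a finite field type \<open>'a\<close> with \<open>CARD('a) = q\<^sup>2\<close>, and a subspace of
  \<open>PG(3,q\<^sup>2)\<close> is the corresponding set of vectors in \<open>'a ^ 4\<close>: points, lines and planes are the
  linear subspaces of dimension 1, 2 and 3, and incidence is inclusion.  The index type \<open>4\<close> has
  the elements 0, 1, 2, 3, so \<open>v $ i\<close> is the homogeneous coordinate \<open>X\<^sub>i\<close>.
\<close>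

definition coords :: "'a \<Rightarrow> 'a \<Rightarrow> 'a \<Rightarrow> 'a \<Rightarrow> 'a ^ 4"
  where "coords a b c d = (\<chi> i. if i = 0 then a else if i = 1 then b else if i = 2 then c else d)"

definition is_point :: "('a::field ^ 4) set \<Rightarrow> bool"
  where "is_point A \<longleftrightarrow> vec.subspace A \<and> vec.dim A = 1"

definition is_line :: "('a::field ^ 4) set \<Rightarrow> bool"
  where "is_line l \<longleftrightarrow> vec.subspace l \<and> vec.dim l = 2"

definition is_plane :: "('a::field ^ 4) set \<Rightarrow> bool"
  where "is_plane E \<longleftrightarrow> vec.subspace E \<and> vec.dim E = 3"

definition herm :: "nat \<Rightarrow> 'a::field ^ 4 \<Rightarrow> 'a ^ 4 \<Rightarrow> 'a"
  where "herm q X Y = X $ 0 * (Y $ 3) ^ q + X $ 3 * (Y $ 0) ^ q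
                      - X $ 1 * (Y $ 1) ^ q - X $ 2 * (Y $ 2) ^ q"

definition herm_surface :: "nat \<Rightarrow> ('a::field ^ 4) set set"
  where "herm_surface q = {A. is_point A \<and> (\<forall>x\<in>A. herm q x x = 0)}"

definition herm_collinear :: "nat \<Rightarrow> ('a::field ^ 4) set \<Rightarrow> ('a ^ 4) set \<Rightarrow> bool"
  where "herm_collinear q A B \<longleftrightarrow> (\<forall>x\<in>A. \<forall>y\<in>B. herm q x y = 0)"

definition pairwise_noncollinear :: "nat \<Rightarrow> ('a::field ^ 4) set set \<Rightarrow> bool"
  where "pairwise_noncollinear q S \<longleftrightarrow> pairwise (\<lambda>A B. \<not> herm_collinear q A B) S"

definition totally_isotropic_line :: "nat \<Rightarrow> ('a::field ^ 4) set \<Rightarrow> bool"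
  where "totally_isotropic_line q l \<longleftrightarrow>
    is_line l \<and> (\<forall>Y. is_point Y \<and> Y \<subseteq> l \<longrightarrow> Y \<in> herm_surface q)"

definition perp :: "nat \<Rightarrow> ('a::field ^ 4) set \<Rightarrow> ('a ^ 4) set"
  where "perp q A = {v. \<forall>x\<in>A. herm q x v = 0}"

definition nondegenerate_plane :: "nat \<Rightarrow> ('a::field ^ 4) set \<Rightarrow> bool"
  where "nondegenerate_plane q E \<longleftrightarrow>
    is_plane E \<and> \<not> (\<exists>x\<in>E. x \<noteq> 0 \<and> (\<forall>y\<in>E. herm q x y = 0))"

text \<open>The subfield of order \<open>q\<close> of the field of order \<open>q\<^sup>2\<close>:\<close>

definition subfield_q :: "nat \<Rightarrow> 'a::field set"
  where "subfield_q q = {x. x ^ q = x}"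

definition baer_subline :: "nat \<Rightarrow> ('a::field ^ 4) set \<Rightarrow> ('a ^ 4) set set \<Rightarrow> bool"
  where "baer_subline q l b \<longleftrightarrow>
    (\<exists>u v. u \<noteq> v \<and> vec.independent {u, v} \<and> vec.span {u, v} = l \<and>
       b = {vec.span {c *s u + d *s v} | c d.
              c \<in> subfield_q q \<and> d \<in> subfield_q q \<and> (c, d) \<noteq> (0, 0)})"

text \<open>Meant for pairwise noncollinear points \<open>A\<close>, \<open>B\<close>, \<open>C\<close> of the Hermitian surface:\<close>

definition in_perspective ::
  "nat \<Rightarrow> ('a::field ^ 4) set \<Rightarrow> ('a ^ 4) set \<Rightarrow> ('a ^ 4) set \<Rightarrow> bool"
  where "in_perspective q A B C \<longleftrightarrow>
    is_line (vec.span ((perp q A \<inter> perp q B) \<union> C) \<inter>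
             vec.span ((perp q B \<inter> perp q C) \<union> A) \<inter>
             vec.span ((perp q C \<inter> perp q A) \<union> B))"

text \<open>The correspondence \<open>F\<^sub>l\<close>.  The line enters only as its domain: \<open>Y\<close> ranges over the points of a
  line on which the unique element exists.\<close>

definition corr ::
  "nat \<Rightarrow> ('a::field ^ 4) set set \<Rightarrow> ('a ^ 4) set \<Rightarrow> ('a ^ 4) set \<Rightarrow> ('a ^ 4) set"
  where "corr q S P Y = (if Y = P then P else (THE Z. Z \<in> S - {P} \<and> herm_collinear q Y Z))"

definition field_automorphism :: "('a::field \<Rightarrow> 'a) \<Rightarrow> bool"
  where "field_automorphism s \<longleftrightarrow>
    bij s \<and> (\<forall>x y. s (x + y) = s x + s y) \<and> (\<forall>x y. s (x * y) = s x * s y)"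

definition semilinear_bij :: "('a::field ^ 4 \<Rightarrow> 'a ^ 4) \<Rightarrow> bool"
  where "semilinear_bij f \<longleftrightarrow>
    bij f \<and> (\<forall>x y. f (x + y) = f x + f y) \<and>
    (\<exists>s. field_automorphism s \<and> (\<forall>c x. f (c *s x) = s c *s f x))"

text \<open>Semilinear maps inducing the elements of \<open>P\<Gamma>U(4,q)\<close>; the collineation induced by \<open>f\<close> sends a
  point \<open>A\<close> to its image \<open>f ` A\<close>.\<close>

definition herm_collineation :: "nat \<Rightarrow> ('a::field ^ 4 \<Rightarrow> 'a ^ 4) \<Rightarrow> bool"
  where "herm_collineation q f \<longleftrightarrow>
    semilinear_bij f \<and> (\<lambda>A. f ` A) ` herm_surface q = herm_surface q"

definition herm_equivalent :: "nat \<Rightarrow> ('a::field ^ 4) set set \<Rightarrow> ('a ^ 4) set set \<Rightarrow> bool"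
  where "herm_equivalent q S T \<longleftrightarrow> (\<exists>f. herm_collineation q f \<and> (\<lambda>A. f ` A) ` S = T)"

definition herm_veronesean :: "nat \<Rightarrow> ('a::field ^ 4) set set"
  where "herm_veronesean q =
    {vec.span {coords 1 x (x ^ q) (x ^ (q + 1))} | x. True} \<union> {vec.span {coords 0 0 0 1}}"

end

theory Submission
  imports Defs
begin

text \<open>
  Write \<open>K\<close> for the field of order \<open>q\<^sup>2\<close>, \<open>k\<close> for its subfield of order \<open>q\<close>, and \<open>cj x = x ^ q\<close>.

  Choose a basis \<open>e0, e1, e2, e3\<close> with \<open>P = \<langle>e3\<rangle>\<close>, \<open>Q = \<langle>e0\<rangle>\<close>, \<open>l = \<langle>e2, e3\<rangle>\<close> in which the form reads
  \<open>x0 cj y3 + x3 cj y0 - x1 cj y2 - x2 cj y1\<close> (\<open>obtain_hyperbolic_frame\<close>).  A point of \<open>S\<close> other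
  than \<open>P\<close> is not collinear with \<open>P\<close>, so it has the form \<open>\<langle>1, u, v, w\<rangle>\<close>, and it is collinear with
  \<open>\<langle>0, 0, 1, t\<rangle>\<close> on \<open>l\<close> iff \<open>t = cj u\<close>.  Condition (i) therefore says that these points form a graph
  \<open>\<langle>1, u, f u, c u\<rangle>\<close> with \<open>u\<close> ranging over \<open>K\<close> (\<open>obtain_graph\<close>).  The Baer sublines of \<open>l\<close> through \<open>P\<close> are the
  affine \<open>k\<close>-lines in the parameter \<open>u\<close>, and (ii) makes \<open>f\<close> affine over \<open>k\<close> along each of them
  (\<open>baer_planes_imp_affine\<close>).  As \<open>q\<close> is odd and \<open>f 0 = 0\<close>, \<open>f\<close> is \<open>k\<close>-linear, that is,
  \<open>f u = \<alpha> u + \<beta> cj u\<close>.  Condition (iii) says that \<open>c u\<close> lies in \<open>k\<close> (\<open>perspective_imp_real\<close>), so the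
  isotropy of the points gives \<open>2 c u = C u\<close> for the quadratic form
  \<open>C u = T u cj u + \<beta> (cj u)\<^sup>2 + cj \<beta> u\<^sup>2\<close>, where \<open>T = \<alpha> + cj \<alpha>\<close>; and \<open>C\<close> is anisotropic because no
  other point of \<open>S\<close> is collinear with \<open>Q\<close>.

  The remaining point is that \<open>T = 0\<close>.  Up to the factor 2, the hermitian product of the points with
  parameters \<open>u\<close> and \<open>v\<close> is \<open>C (u - v) + T (cj u v - u cj v)\<close>, a part in \<open>k\<close> plus a part negated
  by \<open>cj\<close>.  The Gram determinant of three isotropic vectors \<open>x, y, z\<close> is the trace of
  \<open>h(x,y) h(y,z) h(z,x)\<close>.  If \<open>T\<close> is nonzero, fix the differences of three parameters and translate
  them by \<open>t\<close>: the vanishing of that determinant becomes an equation of the form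
  \<open>C t - linear t = constant\<close> over \<open>k\<close>, that is, an ellipse after completing the square.
  It has a solution because an anisotropic binary form represents every element of \<open>k\<close>
  (\<open>binary_form_affine_zero\<close>, \<open>cyclic_product_trace_zero\<close>), and this contradicts (iv).

  When \<open>T = 0\<close>, the vectors above span over \<open>k\<close> a Baer subgeometry on which the form is symmetric,
  and \<open>S\<close> is an elliptic quadric of it, just as the Veronesean is.  An anisotropic binary form over \<open>k\<close> is a multiple
  of the norm in suitable coordinates (\<open>anisotropic_similar_norm\<close>), and that change of coordinates
  extends to a similitude of the hermitian form which maps the Veronesean onto \<open>S\<close>
  (\<open>graph_equivalent_veronesean\<close>).
\<close>

section \<open>The field of order \<open>q\<^sup>2\<close> and its conjugation\<close>

text \<open>
  Multiplication by a nonzero \<open>x\<close> permutes the nonzero elements, so it preserves their product.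
\<close>
lemma finite_field_power_card:
  fixes x :: "'a::{field,finite}"
  shows "x ^ CARD('a) = x"
proof (cases "x = 0")
  case False
  have "prod ((*) x) (UNIV - {0}) = \<Prod>(UNIV - {0})"
    by (rule prod.reindex_bij_witness[of _ "\<lambda>y. y / x" "\<lambda>y. x * y"]) (use False in auto)
  then have "x ^ (CARD('a) - 1) * \<Prod>(UNIV - {0::'a}) = \<Prod>(UNIV - {0::'a})"
    by (simp add: prod.distrib)
  then have "x ^ (CARD('a) - 1) = 1"
    by simp
  then show ?thesis
    by (metis finite_UNIV_card_ge_0 finite power_minus_mult mult_1)
qed (simp add: finite_UNIV_card_ge_0)

text \<open>
  The conjugation is a parameter, tied to \<open>x ^ q\<close> by an assumption, so that the simplifier does not
  mix it with other powers.
\<close>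
locale conjugation_field =
  fixes q :: nat and cj :: "'a::{field,finite} \<Rightarrow> 'a"
  assumes primepow_q: "primepow q" and odd_q: "odd q"
    and card_field: "CARD('a) = q\<^sup>2"
    and cj_power: "cj x = x ^ q"
begin

lemma q_gt_1: "q > 1"
  using primepow_gt_Suc_0[OF primepow_q] by simp

lemma prime_CHAR: "prime CHAR('a)"
  using finite_imp_CHAR_pos[where 'a = 'a] prime_CHAR_semidom[where 'a = 'a] by simp

lemma CHAR_dvd_q: "CHAR('a) dvd q"
proof -
  have "(\<Sum>x\<in>UNIV. x + 1) = (\<Sum>x\<in>UNIV. x :: 'a)"
    by (rule sum.reindex_bij_witness[of _ "\<lambda>x. x - 1" "\<lambda>x. x + 1"]) auto
  then have "of_nat (q\<^sup>2) = (0::'a)"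
    by (simp add: sum.distrib card_field[symmetric])
  then show ?thesis
    using prime_CHAR prime_dvd_power by (metis of_nat_eq_0_iff_char_dvd)
qed

text \<open>
  The characteristic divides the odd number \<open>q\<close>.
\<close>
lemma two_neq_0 [simp]: "(2::'a) \<noteq> 0"
proof
  assume "(2::'a) = 0"
  then have "CHAR('a) dvd 2"
    using of_nat_eq_0_iff_char_dvd[where 'a = 'a, of 2] by simp
  then have "CHAR('a) = 2"
    using prime_CHAR primes_dvd_imp_eq two_is_prime_nat by blast
  then show False
    using CHAR_dvd_q odd_q by simp
qed

lemma cj_add [simp]: "cj (x + y) = cj x + cj y"
proof -
  obtain p k where pk: "prime p" "q = p ^ k"
    using primepow_q unfolding primepow_def by blast
  then have "CHAR('a) = p"
    using CHAR_dvd_q prime_CHAR by (metis prime_dvd_power primes_dvd_imp_eq)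
  then show ?thesis
    unfolding cj_power using freshmans_dream'[OF prime_CHAR] pk by blast
qed

lemma cj_mult [simp]: "cj (x * y) = cj x * cj y"
  by (simp add: cj_power power_mult_distrib)

lemma cj_cj [simp]: "cj (cj x) = x"
  using finite_field_power_card[of x] by (simp add: cj_power card_field power2_eq_square power_mult)

lemma cj_0 [simp]: "cj 0 = 0" and cj_1 [simp]: "cj 1 = 1"
  using q_gt_1 by (simp_all add: cj_power)

lemma cj_minus [simp]: "cj (- x) = - cj x"
  using cj_add[of x "- x"] by (simp add: add_eq_0_iff2 del: cj_add)

lemma cj_diff [simp]: "cj (x - y) = cj x - cj y"
  using cj_add[of x "- y"] by simp

lemma cj_power_nat [simp]: "cj (x ^ n) = cj x ^ n"
  by (simp add: cj_power flip: power_mult) (simp add: mult.commute)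

lemma cj_divide [simp]: "cj (x / y) = cj x / cj y"
  by (simp add: cj_power power_divide)

lemma cj_2 [simp]: "cj 2 = 2"
  using cj_add[of 1 1] by simp

lemma cj_eq_0_iff [simp]: "cj x = 0 \<longleftrightarrow> x = 0"
  using q_gt_1 by (simp add: cj_power)

lemma subfield_iff: "x \<in> subfield_q q \<longleftrightarrow> cj x = x"
  by (simp add: subfield_q_def cj_power)

lemma card_roots_power_le:
  assumes "n > 1"
  shows "card {x::'a. x ^ n = x} \<le> n"
proof -
  let ?p = "monom 1 n - monom 1 1 :: 'a poly"
  have "coeff ?p n = 1"
    using assms by simp
  then have "?p \<noteq> 0"
    by (metis coeff_0 zero_neq_one)
  moreover have "degree ?p \<le> n"
    using assms by (intro degree_diff_le) (simp_all add: degree_monom_eq)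
  moreover have "{x::'a. x ^ n = x} = {x. poly ?p x = 0}"
    by (simp add: poly_monom)
  ultimately show ?thesis
    using card_poly_roots_bound[of ?p] by simp
qed

lemma card_fixed_le: "card {x. cj x = x} \<le> q"
  using card_roots_power_le[OF q_gt_1] by (simp add: cj_power)

lemma obtain_nonfixed:
  obtains \<omega> where "cj \<omega> \<noteq> \<omega>"
proof -
  have "{x. cj x = x} \<noteq> UNIV"
    using card_fixed_le card_field q_gt_1
    by (metis (no_types, lifting) less_le_not_le nat_mult_le_cancel_disj not_less power2_eq_square
        mult.right_neutral neq0_conv)
  then show ?thesis
    using that by blast
qed

lemma card_norm_fibre_le: "card {x. x * cj x = k} \<le> q + 1"
proof -
  let ?p = "monom 1 (q + 1) - [:k:]"
  have "coeff ?p (q + 1) = 1"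
    by (simp add: coeff_pCons split: nat.split)
  then have "?p \<noteq> 0"
    by (metis coeff_0 zero_neq_one)
  moreover have "degree ?p \<le> q + 1"
    by (intro degree_diff_le) (simp_all add: degree_monom_eq)
  moreover have "{x. x * cj x = k} = {x. poly ?p x = 0}"
    by (simp add: poly_monom cj_power)
  ultimately show ?thesis
    using card_poly_roots_bound[of ?p] by simp
qed

text \<open>
  Each fibre of the norm has at most \<open>q + 1\<close> elements and there are at most \<open>q - 1\<close> nonzero values
  fixed by \<open>cj\<close>, so missing one of them would leave too few elements in \<open>K\<close>.
\<close>
lemma norm_surj:
  assumes "cj k = k"
  obtains x where "x * cj x = k"
proof -
  have "\<exists>x. x * cj x = k"
  proof (rule ccontr)
    assume no: "\<nexists>x. x * cj x = k"
    then have "k \<noteq> 0"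
      by (metis mult_zero_left)
    \<comment> \<open>The possible nonzero values of the norm.\<close>
    let ?F = "{x. cj x = x} - {0, k}"
    have "card ?F = card {x. cj x = x} - 2"
      using \<open>k \<noteq> 0\<close> assms by (subst card_Diff_subset) auto
    then have F: "card ?F \<le> q - 2"
      using card_fixed_le by simp
    have "UNIV - {0} \<subseteq> (\<Union>y\<in>?F. {x. x * cj x = y})"
      using no by (auto simp: mult.commute)
    then have "card (UNIV - {0::'a}) \<le> card (\<Union>y\<in>?F. {x. x * cj x = y})"
      by (intro card_mono) simp_all
    also have "\<dots> \<le> (\<Sum>y\<in>?F. card {x. x * cj x = y})"
      by (rule card_UN_le) simp
    also have "\<dots> \<le> card ?F * (q + 1)"
      using sum_bounded_above[of ?F "\<lambda>y. card {x. x * cj x = y}" "q + 1"] card_norm_fibre_le by simp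
    also have "\<dots> \<le> (q - 2) * (q + 1)"
      using F by (rule mult_le_mono1)
    finally have "q * q - 1 \<le> (q - 2) * (q + 1)"
      using card_field by (simp add: power2_eq_square)
    moreover obtain m where "q = m + 2"
      using q_gt_1 by (metis Suc_1 Suc_leI add.commute le_Suc_ex)
    ultimately show False
      by (simp add: algebra_simps)
  qed
  then show ?thesis
    using that by blast
qed

text \<open>
  An element of the subfield is a norm \<open>x ^ (q + 1)\<close>, and \<open>q + 1\<close> is even.
\<close>
lemma fixed_sqrt:
  assumes "cj k = k"
  obtains r where "r\<^sup>2 = k"
proof -
  obtain x where x: "x * cj x = k"
    using norm_surj assms by blast
  have "(q + 1) div 2 * 2 = q + 1"
    using odd_q by presburger
  then have "(x ^ ((q + 1) div 2))\<^sup>2 = x ^ (q + 1)"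
    by (metis power_mult)
  then show ?thesis
    using that x by (simp add: cj_power)
qed

text \<open>
  An element outside the subfield forms a basis of \<open>K\<close> together with \<open>1\<close>; maps that are
  linear over the subfield are determined by their values on it, and \<open>\<alpha>\<close>, \<open>\<beta>\<close> solve a \<open>2 \<times> 2\<close> system.
\<close>
lemma real_linear_form:
  assumes add: "\<And>x y. f (x + y) = f x + f y"
    and scale: "\<And>r x. cj r = r \<Longrightarrow> f (r * x) = r * f x"
  obtains \<alpha> \<beta> where "\<And>x. f x = \<alpha> * x + \<beta> * cj x"
proof -
  obtain \<omega> where \<omega>: "cj \<omega> \<noteq> \<omega>"
    using obtain_nonfixed .
  define \<beta> where "\<beta> = (f \<omega> - \<omega> * f 1) / (cj \<omega> - \<omega>)"
  define \<alpha> where "\<alpha> = f 1 - \<beta>"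
  have f1: "f 1 = \<alpha> + \<beta>"
    by (simp add: \<alpha>_def)
  have "\<beta> * (cj \<omega> - \<omega>) = f \<omega> - \<omega> * f 1"
    using \<omega> by (simp add: \<beta>_def)
  then have f\<omega>: "f \<omega> = \<alpha> * \<omega> + \<beta> * cj \<omega>"
    by (simp add: f1 algebra_simps)
  have "f x = \<alpha> * x + \<beta> * cj x" for x
  proof -
    define s where "s = (x - cj x) / (\<omega> - cj \<omega>)"
    define r where "r = x - s * \<omega>"
    have s: "s * (\<omega> - cj \<omega>) = x - cj x"
      using \<omega> by (simp add: s_def)
    have cs: "cj s = s"
      using \<omega> unfolding s_def by (simp add: divide_simps) (simp add: algebra_simps)
    have cr: "cj r = r"
      using s by (simp add: r_def cs algebra_simps)
    have x: "x = r * 1 + s * \<omega>"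
      by (simp add: r_def)
    have "f x = r * f 1 + s * f \<omega>"
      by (subst x) (simp only: add scale[OF cr] scale[OF cs])
    moreover have "cj x = r + s * cj \<omega>"
      by (subst x) (simp add: cr cs)
    ultimately show ?thesis
      by (subst (2) x) (simp add: f1 f\<omega> algebra_simps)
  qed
  then show ?thesis
    using that by blast
qed

section \<open>Quadratic forms over the subfield\<close>

text \<open>
  The trace of \<open>cj x * f x\<close> for \<open>f x = \<alpha> * x + \<beta> * cj x\<close> and \<open>T = \<alpha> + cj \<alpha>\<close>.  If \<open>cj T = T\<close>, it is a
  quadratic form on \<open>K\<close>, regarded as a plane over the subfield.
\<close>
definition binary_form :: "'a \<Rightarrow> 'a \<Rightarrow> 'a \<Rightarrow> 'a"
  where "binary_form T \<beta> x = T * (x * cj x) + \<beta> * (cj x)\<^sup>2 + cj \<beta> * x\<^sup>2"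

text \<open>
  The substitution \<open>x \<mapsto> \<kappa> * x + cj x\<close> turns the coefficient of \<open>x\<^sup>2\<close> into
  \<open>cj \<beta> * \<kappa>\<^sup>2 + T * \<kappa> + \<beta>\<close>, and that of \<open>(cj x)\<^sup>2\<close> into its conjugate.  The discriminant of this
  quadratic polynomial lies in the subfield, hence is a square in \<open>K\<close>, so \<open>\<kappa>\<close> can be chosen as a root
  (\<open>\<kappa> = 0\<close> if \<open>\<beta> = 0\<close>) and only a multiple of the norm is left.
\<close>
lemma anisotropic_similar_norm:
  assumes T: "cj T = T"
    and anis: "\<And>x. x \<noteq> 0 \<Longrightarrow> binary_form T \<beta> x \<noteq> 0"
  obtains \<kappa> \<mu> where "cj \<beta> * \<kappa>\<^sup>2 + T * \<kappa> + \<beta> = 0"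
    and "\<mu> = T * (\<kappa> * cj \<kappa> + 1) + 2 * (\<beta> * cj \<kappa> + cj \<beta> * \<kappa>)"
    and "\<And>x. binary_form T \<beta> (\<kappa> * x + cj x) = \<mu> * (x * cj x)"
    and "\<mu> \<noteq> 0" and "cj \<mu> = \<mu>"
proof -
  obtain \<kappa> where root: "cj \<beta> * \<kappa>\<^sup>2 + T * \<kappa> + \<beta> = 0"
  proof (cases "\<beta> = 0")
    case True
    then show ?thesis
      by (intro that[of 0]) simp
  next
    case False
    obtain d where d: "d\<^sup>2 = T\<^sup>2 - 4 * (\<beta> * cj \<beta>)"
    proof (rule fixed_sqrt)
      have "cj 4 = (4::'a)"
        using cj_mult[of 2 2] by simp
      then show "cj (T\<^sup>2 - 4 * (\<beta> * cj \<beta>)) = T\<^sup>2 - 4 * (\<beta> * cj \<beta>)"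
        by (simp add: T)
    qed
    define \<kappa> where "\<kappa> = (d - T) / (2 * cj \<beta>)"
    have k: "2 * cj \<beta> * \<kappa> = d - T"
      using False by (simp add: \<kappa>_def)
    have "4 * cj \<beta> * (cj \<beta> * \<kappa>\<^sup>2 + T * \<kappa> + \<beta>)
      = (2 * cj \<beta> * \<kappa>)\<^sup>2 + 2 * T * (2 * cj \<beta> * \<kappa>) + 4 * (\<beta> * cj \<beta>)"
      by (simp add: algebra_simps power2_eq_square)
    also have "\<dots> = d\<^sup>2 - (T\<^sup>2 - 4 * (\<beta> * cj \<beta>))"
      unfolding k by (simp add: algebra_simps power2_eq_square)
    also have "\<dots> = 0"
      using d by simp
    finally have "2 * 2 * cj \<beta> * (cj \<beta> * \<kappa>\<^sup>2 + T * \<kappa> + \<beta>) = 0"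
      by simp
    then show ?thesis
      using False two_neq_0 by (intro that[of \<kappa>]) (metis cj_eq_0_iff mult_eq_0_iff)
  qed
  define \<mu> where "\<mu> = T * (\<kappa> * cj \<kappa> + 1) + 2 * (\<beta> * cj \<kappa> + cj \<beta> * \<kappa>)"
  have root': "\<beta> * (cj \<kappa>)\<^sup>2 + T * cj \<kappa> + cj \<beta> = 0"
    using arg_cong[OF root, of cj] by (simp add: T)
  have form: "binary_form T \<beta> (\<kappa> * x + cj x) = \<mu> * (x * cj x)" for x
  proof -
    have "binary_form T \<beta> (\<kappa> * x + cj x) = (cj \<beta> * \<kappa>\<^sup>2 + T * \<kappa> + \<beta>) * x\<^sup>2
      + (\<beta> * (cj \<kappa>)\<^sup>2 + T * cj \<kappa> + cj \<beta>) * (cj x)\<^sup>2 + \<mu> * (x * cj x)"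
      by (simp add: binary_form_def \<mu>_def algebra_simps power2_eq_square)
    then show ?thesis
      by (simp add: root root')
  qed
  have "\<mu> \<noteq> 0"
  proof
    assume "\<mu> = 0"
    then have zero: "\<kappa> * x + cj x = 0" for x
      using form[of x] anis[of "\<kappa> * x + cj x"] by (metis mult_zero_left)
    obtain \<omega> where "cj \<omega> \<noteq> \<omega>"
      using obtain_nonfixed .
    moreover have "\<kappa> = - 1"
      using zero[of 1] by (simp add: eq_neg_iff_add_eq_0)
    ultimately show False
      using zero[of \<omega>] by simp
  qed
  moreover have "cj \<mu> = \<mu>"
    by (simp add: \<mu>_def T algebra_simps)
  ultimately show ?thesis
    using that root \<mu>_def form by blast
qed

lemma binary_form_represents:
  assumes "cj T = T" and "\<And>x. x \<noteq> 0 \<Longrightarrow> binary_form T \<beta> x \<noteq> 0" and "cj k = k"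
  obtains x where "binary_form T \<beta> x = k"
proof -
  obtain \<kappa> \<mu> where *: "\<And>x. binary_form T \<beta> (\<kappa> * x + cj x) = \<mu> * (x * cj x)" "\<mu> \<noteq> 0" "cj \<mu> = \<mu>"
    using anisotropic_similar_norm[OF assms(1,2)] by metis
  obtain x where "x * cj x = k / \<mu>"
    using norm_surj[of "k / \<mu>"] * assms(3) by auto
  with * that show ?thesis
    by (metis nonzero_mult_div_cancel_left times_divide_eq_right)
qed

text \<open>
  Completing the square: \<open>M\<close> is the gradient of the form.  It is injective because \<open>2 * C x\<close> is the
  trace of \<open>x * M x\<close>, hence it attains \<open>e\<close>, and translating by a preimage removes the linear term.
\<close>
lemma binary_form_affine_zero:
  assumes T: "cj T = T" and anis: "\<And>x. x \<noteq> 0 \<Longrightarrow> binary_form T \<beta> x \<noteq> 0" and k: "cj k = k"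
  obtains t where "binary_form T \<beta> t - (e * t + cj e * cj t) = k"
proof -
  define M where "M s = T * cj s + 2 * cj \<beta> * s" for s
  have M_diff: "M (x - y) = M x - M y" for x y
    by (simp add: M_def algebra_simps)
  have "x = 0" if "M x = 0" for x
  proof -
    have "2 * binary_form T \<beta> x = x * M x + cj (x * M x)"
      by (simp add: binary_form_def M_def T algebra_simps power2_eq_square)
    with that anis show ?thesis
      by (metis add_0 cj_0 mult_eq_0_iff mult_zero_right two_neq_0)
  qed
  then have "inj M"
    by (intro injI) (metis M_diff eq_iff_diff_eq_0)
  then obtain s where s: "M s = e"
    by (metis finite_UNIV_inj_surj surj_def finite)
  have "cj (binary_form T \<beta> s) = binary_form T \<beta> s"
    by (simp add: binary_form_def T algebra_simps)
  then obtain x where x: "binary_form T \<beta> x = k + binary_form T \<beta> s"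
    using binary_form_represents[OF T anis, of "k + binary_form T \<beta> s"] k by auto
  have "binary_form T \<beta> (x + s) - (M s * (x + s) + cj (M s) * cj (x + s))
    = binary_form T \<beta> x - binary_form T \<beta> s"
    by (simp add: binary_form_def M_def T algebra_simps power2_eq_square)
  then show ?thesis
    using that[of "x + s"] x by (simp add: s)
qed

text \<open>
  The determinant over the subfield, up to a constant: it is alternating, and its values are negated
  by \<open>cj\<close>.
\<close>
definition alt_form :: "'a \<Rightarrow> 'a \<Rightarrow> 'a"
  where "alt_form x y = cj x * y - x * cj y"

text \<open>
  The parameters are \<open>t + 1, t + b, t\<close> with \<open>b\<close> outside the subfield and \<open>t\<close> to be found.  With \<open>C\<close>
  the quadratic form, \<open>D = alt_form 1 b\<close>, \<open>X = alt_form t 1\<close> and \<open>Y = alt_form t b\<close>, the three factors are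
  \<open>C (1 - b) + T * (D + Y - X)\<close>, \<open>C b - T * Y\<close> and \<open>C 1 + T * X\<close>.  The part of the trace that is quadratic in
  \<open>t\<close> is a constant times the value of \<open>C\<close> at \<open>(b * X - Y) / D\<close>, where \<open>X / D\<close> and \<open>Y / D\<close>
  lie in the subfield, and this element is \<open>- t\<close> (a Pluecker relation).  So the trace vanishes iff \<open>C t\<close> minus a linear form is a
  constant.
\<close>
lemma cyclic_product_trace_zero:
  assumes T: "cj T = T" "T \<noteq> 0" and anis: "\<And>x. x \<noteq> 0 \<Longrightarrow> binary_form T \<beta> x \<noteq> 0"
  defines "H \<equiv> \<lambda>u v. binary_form T \<beta> (u - v) + T * alt_form u v"
  obtains u v w where "u \<noteq> v" "v \<noteq> w" "u \<noteq> w"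
    "H u v * H v w * H w u + cj (H u v * H v w * H w u) = 0"
proof -
  obtain b where b: "cj b \<noteq> b"
    using obtain_nonfixed .
  define C where "C = binary_form T \<beta>"
  define D where "D = b - cj b"
  define k where "k = C (1 - b) * C 1 * C b / (T\<^sup>2 * D\<^sup>2)"
  define e where "e = (C 1 * cj b - C b) / D"
  have D: "D \<noteq> 0" "cj D = - D"
    using b by (simp_all add: D_def)
  have cC: "cj (C x) = C x" for x
    by (simp add: C_def binary_form_def T algebra_simps)
  have "cj k = k"
    by (simp add: k_def cC T D)
  then obtain t where t: "C t - (e * t + cj e * cj t) = k"
    using binary_form_affine_zero[OF T(1) anis] unfolding C_def by blast
  define X Y where "X = cj t - t" and "Y = cj t * b - t * cj b"
  have cXY: "cj X = - X" "cj Y = - Y"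
    by (simp_all add: X_def Y_def)
  have eD: "e * D = C 1 * cj b - C b" "cj e * D = C b - C 1 * b"
  proof -
    show "e * D = C 1 * cj b - C b"
      using D by (simp add: e_def)
    have "cj e = (C 1 * b - C b) / - D"
      by (simp add: e_def D cC)
    then show "cj e * D = C b - C 1 * b"
      using D by simp
  qed
  have "T\<^sup>2 * D\<^sup>2 * (C t - (e * t + cj e * cj t)) = C (1 - b) * C 1 * C b"
    using t T(2) D by (simp add: k_def)
  then have "C (1 - b) * C 1 * C b = T\<^sup>2 * (D\<^sup>2 * C t - D * ((e * D) * t + (cj e * D) * cj t))"
    by (simp add: algebra_simps power2_eq_square)
  also have "\<dots> = T\<^sup>2 * (D\<^sup>2 * C t - D * (C b * X - C 1 * Y))"
    unfolding eD X_def Y_def by (simp add: algebra_simps)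
  finally have eq: "C (1 - b) * C 1 * C b = T\<^sup>2 * (D\<^sup>2 * C t - D * (C b * X - C 1 * Y))" .
  \<comment> \<open>\<open>X / D\<close> and \<open>Y / D\<close> are fixed by \<open>cj\<close>, and \<open>b * (X / D) - Y / D = - t\<close>.\<close>
  have quad: "D\<^sup>2 * C t = C b * X\<^sup>2 + C 1 * Y\<^sup>2 - (C 1 + C b - C (1 - b)) * X * Y"
    by (simp add: D_def C_def binary_form_def X_def Y_def algebra_simps power2_eq_square)
  have H1: "H (t + 1) (t + b) = C (1 - b) + T * (D + Y - X)"
    unfolding H_def C_def alt_form_def D_def X_def Y_def by (simp add: algebra_simps)
  have H2: "H (t + b) t = C b - T * Y"
    unfolding H_def C_def alt_form_def Y_def by (simp add: algebra_simps)
  have "C (- 1) = C 1"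
    by (simp add: C_def binary_form_def)
  then have H3: "H t (t + 1) = C 1 + T * X"
    unfolding H_def C_def[symmetric] alt_form_def X_def by (simp add: algebra_simps)
  have "H (t + 1) (t + b) * H (t + b) t * H t (t + 1)
      + cj (H (t + 1) (t + b) * H (t + b) t * H t (t + 1)) =
    2 * (C (1 - b) * C 1 * C b
      - T\<^sup>2 * (C b * X\<^sup>2 + C 1 * Y\<^sup>2 - (C 1 + C b - C (1 - b)) * X * Y - D * (C b * X - C 1 * Y)))"
    unfolding H1 H2 H3 cj_mult cj_add cj_diff cC cXY T(1) D(2) by algebra
  also have "\<dots> = 0"
    unfolding quad[symmetric] eq by simp
  finally show ?thesis
    using b by (intro that[of "t + 1" "t + b" t]) auto
qed

end

section \<open>The hermitian form on points, lines and planes\<close>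

lemma coords_nth [simp]:
  "coords a b c d $ 0 = a" "coords a b c d $ 1 = b" "coords a b c d $ 2 = c" "coords a b c d $ 3 = d"
  by (simp_all add: coords_def)

lemma vec4_eq_iff: "v = w \<longleftrightarrow> v $ 0 = w $ 0 \<and> v $ 1 = w $ 1 \<and> v $ 2 = w $ 2 \<and> v $ 3 = w $ (3::4)"
proof -
  have "(4::4) = 0"
    by simp
  then show ?thesis
    unfolding vec_eq_iff forall_4 by metis
qed

lemma is_point_iff: "is_point A \<longleftrightarrow> (\<exists>v. v \<noteq> 0 \<and> A = vec.span {v})"
proof
  assume A: "is_point A"
  obtain B where B: "B \<subseteq> A" "vec.independent B" "A \<subseteq> vec.span B" "card B = vec.dim A"
    using vec.basis_exists by blast
  then have "card B = 1"
    using A by (simp add: is_point_def)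
  then obtain v where v: "B = {v}"
    by (rule card_1_singletonE)
  have "vec.span B = A"
    using A B by (metis is_point_def subset_antisym vec.span_minimal)
  moreover have "v \<noteq> 0"
    using B(2) v by (metis singletonI vec.dependent_zero)
  ultimately show "\<exists>v. v \<noteq> 0 \<and> A = vec.span {v}"
    using v by blast
next
  assume "\<exists>v. v \<noteq> 0 \<and> A = vec.span {v}"
  then obtain v where v: "v \<noteq> 0" "A = vec.span {v}"
    by blast
  then have "vec.independent {v}"
    by simp
  then have "vec.dim {v} = card {v}"
    by (rule vec.dim_eq_card_independent)
  then show "is_point A"
    using v by (simp add: is_point_def vec.dim_span)
qed

lemma in_span_singleton_iff: "w \<in> vec.span {v} \<longleftrightarrow> (\<exists>k. w = k *s v)"
  by (auto simp: vec.span_singleton)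

lemma span_singleton_scale:
  fixes v :: "'a::field ^ 'n"
  assumes "k \<noteq> 0"
  shows "vec.span {k *s v} = vec.span {v}"
proof -
  have "w \<in> vec.span {k *s v} \<longleftrightarrow> w \<in> vec.span {v}" for w
    unfolding in_span_singleton_iff using assms
    by (metis vector_smult_assoc mult.commute nonzero_divide_eq_eq)
  then show ?thesis
    by blast
qed

context conjugation_field
begin

lemma herm_cj:
  "herm q (x :: 'a ^ 4) y = x $ 0 * cj (y $ 3) + x $ 3 * cj (y $ 0) - x $ 1 * cj (y $ 1) - x $ 2 * cj (y $ 2)"
  by (simp add: herm_def cj_power)

lemma herm_add [simp]:
  "herm q (x + y :: 'a ^ 4) z = herm q x z + herm q y z" "herm q z (x + y :: 'a ^ 4) = herm q z x + herm q z y"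
  by (simp_all add: herm_cj algebra_simps)

lemma herm_diff [simp]:
  "herm q (x - y :: 'a ^ 4) z = herm q x z - herm q y z" "herm q z (x - y :: 'a ^ 4) = herm q z x - herm q z y"
  by (simp_all add: herm_cj algebra_simps)

lemma herm_minus [simp]: "herm q (- x :: 'a ^ 4) z = - herm q x z" "herm q z (- x :: 'a ^ 4) = - herm q z x"
  by (simp_all add: herm_cj)

lemma herm_scale [simp]:
  "herm q (k *s x :: 'a ^ 4) z = k * herm q x z" "herm q z (k *s x :: 'a ^ 4) = cj k * herm q z x"
  by (simp_all add: herm_cj algebra_simps)

lemma herm_0 [simp]: "herm q (0 :: 'a ^ 4) z = 0" "herm q z (0 :: 'a ^ 4) = 0"
  by (simp_all add: herm_cj)

lemma herm_sym: "herm q (x :: 'a ^ 4) y = cj (herm q y x)"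
  by (simp add: herm_cj algebra_simps)

lemma herm_eq_0_sym: "herm q (x :: 'a ^ 4) y = 0 \<longleftrightarrow> herm q y x = 0"
  by (metis cj_eq_0_iff herm_sym)

lemma herm_nondegenerate:
  fixes v :: "'a ^ 4"
  assumes "\<And>x. herm q x v = 0"
  shows "v = 0"
  using assms[of "coords 1 0 0 0"] assms[of "coords 0 1 0 0"]
    assms[of "coords 0 0 1 0"] assms[of "coords 0 0 0 1"]
  by (simp add: herm_cj vec4_eq_iff)

lemma herm_surface_iff:
  "(A :: ('a ^ 4) set) \<in> herm_surface q \<longleftrightarrow> (\<exists>v. v \<noteq> 0 \<and> herm q v v = 0 \<and> A = vec.span {v})"
proof
  assume "A \<in> herm_surface q"
  then obtain v where "v \<noteq> 0" "A = vec.span {v}" "\<forall>x\<in>A. herm q x x = 0"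
    unfolding herm_surface_def is_point_iff by blast
  then show "\<exists>v. v \<noteq> 0 \<and> herm q v v = 0 \<and> A = vec.span {v}"
    by (metis singletonI vec.span_base)
next
  assume "\<exists>v. v \<noteq> 0 \<and> herm q v v = 0 \<and> A = vec.span {v}"
  then obtain v where v: "v \<noteq> 0" "herm q v v = 0" "A = vec.span {v}"
    by blast
  then have "herm q x x = 0" if "x \<in> A" for x
    using that by (auto simp: in_span_singleton_iff)
  then show "A \<in> herm_surface q"
    using v by (auto simp: herm_surface_def is_point_iff)
qed

lemma herm_collinear_span:
  "herm_collinear q (vec.span {x :: 'a ^ 4}) (vec.span {y}) \<longleftrightarrow> herm q x y = 0"
proof
  assume "herm q x y = 0"
  then show "herm_collinear q (vec.span {x}) (vec.span {y})"
    by (auto simp: herm_collinear_def in_span_singleton_iff)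
qed (simp add: herm_collinear_def vec.span_base)

text \<open>
  Isotropy of \<open>k *s x + y\<close> says that \<open>k * h(x,y)\<close> has trace zero; for \<open>k = 1 / h(x,y)\<close> the trace is 2.
\<close>
lemma totally_isotropic_orthogonal:
  fixes l :: "('a ^ 4) set"
  assumes l: "totally_isotropic_line q l" and "x \<in> l" "y \<in> l"
  shows "herm q x y = 0"
proof -
  have sub: "vec.subspace l"
    using l by (simp add: totally_isotropic_line_def is_line_def)
  have iso: "herm q z z = 0" if "z \<in> l" for z
  proof (cases "z = 0")
    case False
    have "vec.span {z} \<subseteq> l"
      using sub that by (simp add: vec.span_minimal)
    then have "vec.span {z} \<in> herm_surface q"
      using l False by (auto simp: totally_isotropic_line_def is_point_iff)
    then show ?thesis
      by (simp add: herm_surface_def vec.span_base)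
  qed simp
  have trace: "k * herm q x y + cj (k * herm q x y) = 0" for k
  proof -
    have "k *s x + y \<in> l"
      using assms sub by (simp add: vec.subspace_add vec.subspace_scale)
    then have "herm q (k *s x + y) (k *s x + y) = 0"
      by (rule iso)
    then show ?thesis
      using iso assms by (simp add: herm_sym[of y x] add.commute)
  qed
  show ?thesis
  proof (rule ccontr)
    assume "herm q x y \<noteq> 0"
    then show False
      using trace[of "1 / herm q x y"] two_neq_0 by (simp add: one_add_one)
  qed
qed

text \<open>
  The hypothesis on the cyclic product is the vanishing of the Gram determinant; the radical vector
  \<open>w\<close> is read off from the cofactors.  If \<open>w\<close> is zero, the points do not span a plane.
\<close>
lemma gram_degenerate:
  fixes x y z :: "'a ^ 4"
  assumes iso: "herm q x x = 0" "herm q y y = 0" "herm q z z = 0"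
    and xy: "herm q x y \<noteq> 0"
    and N: "herm q x y * herm q y z * herm q z x + cj (herm q x y * herm q y z * herm q z x) = 0"
  shows "\<not> nondegenerate_plane q (vec.span (vec.span {x} \<union> vec.span {y} \<union> vec.span {z}))"
proof
  let ?E = "vec.span (vec.span {x} \<union> vec.span {y} \<union> vec.span {z})"
  assume nondeg: "nondegenerate_plane q ?E"
  have E: "?E = vec.span {x, y, z}"
  proof
    show "?E \<subseteq> vec.span {x, y, z}"
      by (intro vec.span_minimal Un_least vec.span_mono vec.subspace_span) auto
    show "vec.span {x, y, z} \<subseteq> ?E"
      by (intro vec.span_mono) (auto simp: vec.span_base)
  qed
  define w where "w = z - (cj (herm q y z) / herm q x y) *s x - (herm q z x / cj (herm q x y)) *s y"
  have wx: "herm q w x = 0"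
    using xy by (simp add: w_def iso herm_sym[of y x])
  have wy: "herm q w y = 0"
    using xy by (simp add: w_def iso herm_sym[of z y])
  have "herm q x y * cj (herm q x y) * herm q w z
    = - (herm q x y * herm q y z * herm q z x + cj (herm q x y * herm q y z * herm q z x))"
    using xy by (simp add: w_def iso herm_sym[of x z] field_simps)
  also have "\<dots> = 0"
    unfolding N by simp
  finally have wz: "herm q w z = 0"
    using xy by simp
  have "w \<in> ?E"
    unfolding E w_def by (intro vec.span_diff vec.span_scale vec.span_base) auto
  moreover have "herm q w v = 0" if "v \<in> ?E" for v
    using that unfolding E
  proof (induction rule: vec.span_induct)
    show "vec.subspace {v. herm q w v = 0}"
      by (auto simp: vec.subspace_def)
  qed (use wx wy wz in auto)
  moreover have "w \<noteq> 0"
  proof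
    assume "w = 0"
    then have "z = (cj (herm q y z) / herm q x y) *s x + (herm q z x / cj (herm q x y)) *s y"
      by (simp add: w_def algebra_simps)
    then have "z \<in> vec.span {x, y}"
      by (metis insertCI vec.span_add vec.span_base vec.span_scale)
    then have "vec.span {x, y, z} \<subseteq> vec.span {x, y}"
      by (intro vec.span_minimal) (auto simp: vec.span_base)
    then have "vec.dim ?E \<le> card {x, y}"
      unfolding E by (intro vec.dim_le_card) auto
    moreover have "card {x, y} \<le> 2"
      by (simp add: card_insert_le_m1)
    ultimately show False
      using nondeg by (simp add: nondegenerate_plane_def is_plane_def)
  qed
  ultimately show False
    using nondeg by (auto simp: nondegenerate_plane_def)
qed

text \<open>
  A similitude is injective since the form is nondegenerate, hence bijective on a finite space.  The
  map goes from \<open>V\<close> to \<open>S\<close> because it is easier to write down in that direction.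
\<close>
lemma herm_equivalent_by_similitude:
  fixes \<phi> :: "'a ^ 4 \<Rightarrow> 'a ^ 4"
  assumes add: "\<And>x y. \<phi> (x + y) = \<phi> x + \<phi> y" and scale: "\<And>k x. \<phi> (k *s x) = k *s \<phi> x"
    and sim: "\<And>x y. herm q (\<phi> x) (\<phi> y) = \<mu> * herm q x y" and \<mu>: "\<mu> \<noteq> 0"
    and image: "(\<lambda>A. \<phi> ` A) ` V = S"
  shows "herm_equivalent q S V"
proof -
  have zero: "\<phi> x = 0 \<Longrightarrow> x = 0" for x
  proof -
    assume "\<phi> x = 0"
    then have "herm q y x = 0" for y
      using sim[of y x] \<mu> by simp
    then show "x = 0"
      by (rule herm_nondegenerate)
  qed
  have "inj \<phi>"
  proof (rule injI)
    fix x y assume "\<phi> x = \<phi> y"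
    moreover have "\<phi> (x - y) + \<phi> y = \<phi> x"
      using add[of "x - y" y] by simp
    ultimately show "x = y"
      using zero[of "x - y"] by simp
  qed
  then have bij: "bij \<phi>"
    by (simp add: bij_def finite_UNIV_inj_surj)
  have span: "\<phi> ` vec.span {v} = vec.span {\<phi> v}" for v
    by (auto simp: vec.span_singleton scale image_iff)
  have phi0: "\<phi> 0 = 0"
    using scale[of 0 0] by simp
  have surface: "(\<lambda>A. \<phi> ` A) ` herm_surface q = herm_surface q"
  proof (intro set_eqI iffI)
    fix A :: "('a ^ 4) set" assume "A \<in> (\<lambda>A. \<phi> ` A) ` herm_surface q"
    then obtain v where "v \<noteq> 0" "herm q v v = 0" "A = vec.span {\<phi> v}"
      by (auto simp: herm_surface_iff span)
    then show "A \<in> herm_surface q"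
      unfolding herm_surface_iff using zero sim by (intro exI[of _ "\<phi> v"]) auto
  next
    fix A :: "('a ^ 4) set" assume "A \<in> herm_surface q"
    then obtain v where v: "v \<noteq> 0" "herm q v v = 0" "A = vec.span {v}"
      by (auto simp: herm_surface_iff)
    obtain w where w: "v = \<phi> w"
      using bij by (metis bij_pointE)
    have "w \<noteq> 0" "herm q w w = 0"
      using v w sim[of w w] \<mu> phi0 by auto
    then have "vec.span {w} \<in> herm_surface q"
      by (auto simp: herm_surface_iff)
    moreover have "A = \<phi> ` vec.span {w}"
      using v w span by simp
    ultimately show "A \<in> (\<lambda>A. \<phi> ` A) ` herm_surface q"
      by blast
  qed
  define \<psi> where "\<psi> = inv \<phi>"
  have psi: "\<psi> (\<phi> x) = x" "\<phi> (\<psi> x) = x" for x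
    using bij by (simp_all add: \<psi>_def bij_def surj_f_inv_f)
  have undo: "(\<lambda>A. \<psi> ` A) ` ((\<lambda>A. \<phi> ` A) ` X) = X" for X :: "('a ^ 4) set set"
    by (simp add: image_image psi)
  have "bij \<psi>"
    unfolding \<psi>_def using bij by (rule bij_imp_bij_inv)
  moreover have "\<psi> (x + y) = \<psi> x + \<psi> y" for x y
    by (metis add psi)
  moreover have "\<psi> (k *s x) = k *s \<psi> x" for k x
    by (metis scale psi)
  moreover have "field_automorphism (\<lambda>x::'a. x)"
    by (simp add: field_automorphism_def bij_id[unfolded id_def])
  ultimately have "semilinear_bij \<psi>"
    unfolding semilinear_bij_def by blast
  moreover have "(\<lambda>A. \<psi> ` A) ` herm_surface q = herm_surface q"
    using undo[of "herm_surface q"] unfolding surface .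
  ultimately have "herm_collineation q \<psi>"
    unfolding herm_collineation_def by blast
  moreover have "(\<lambda>A. \<psi> ` A) ` S = V"
    using undo[of V] unfolding image .
  ultimately show ?thesis
    unfolding herm_equivalent_def by blast
qed

end

section \<open>Hyperbolic frames\<close>
locale hyperbolic_frame = conjugation_field q cj
  for q and cj :: "'a::{field,finite} \<Rightarrow> 'a" +
  fixes e0 e1 e2 e3 :: "'a ^ 4"
  assumes frame_isotropic: "herm q e0 e0 = 0" "herm q e1 e1 = 0" "herm q e2 e2 = 0" "herm q e3 e3 = 0"
    and frame_orthogonal: "herm q e0 e1 = 0" "herm q e0 e2 = 0" "herm q e1 e3 = 0" "herm q e2 e3 = 0"
    and frame_pairs: "herm q e0 e3 = 1" "herm q e1 e2 = - 1"
begin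

definition frame_vec :: "'a \<Rightarrow> 'a \<Rightarrow> 'a \<Rightarrow> 'a \<Rightarrow> 'a ^ 4"
  where "frame_vec a b c d = a *s e0 + b *s e1 + c *s e2 + d *s e3"

lemma herm_frame_vec [simp]:
  "herm q (frame_vec a b c d) (frame_vec a' b' c' d')
    = a * cj d' + d * cj a' - b * cj c' - c * cj b'"
proof -
  have "herm q e1 e0 = 0" "herm q e2 e0 = 0" "herm q e3 e1 = 0" "herm q e3 e2 = 0"
    using frame_orthogonal by (simp_all add: herm_eq_0_sym)
  moreover have "herm q e3 e0 = 1" "herm q e2 e1 = - 1"
    using frame_pairs by (simp_all add: herm_sym[of e3 e0] herm_sym[of e2 e1])
  ultimately show ?thesis
    by (simp add: frame_vec_def frame_isotropic frame_orthogonal frame_pairs algebra_simps)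
qed

lemma frame_vec_add:
  "frame_vec a b c d + frame_vec a' b' c' d' = frame_vec (a + a') (b + b') (c + c') (d + d')"
  by (simp add: frame_vec_def vector_sadd_rdistrib)

lemma frame_vec_scale: "k *s frame_vec a b c d = frame_vec (k * a) (k * b) (k * c) (k * d)"
  by (simp add: frame_vec_def vector_add_ldistrib vector_smult_assoc)

lemma frame_vec_diff:
  "frame_vec a b c d - frame_vec a' b' c' d' = frame_vec (a - a') (b - b') (c - c') (d - d')"
  by (simp add: frame_vec_def vector_sub_rdistrib)

lemma frame_vec_basis:
  "frame_vec 1 0 0 0 = e0" "frame_vec 0 1 0 0 = e1" "frame_vec 0 0 1 0 = e2" "frame_vec 0 0 0 1 = e3"
  by (simp_all add: frame_vec_def)

lemma herm_frame_vec_basis: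
  "herm q (frame_vec a b c d) e0 = d" "herm q (frame_vec a b c d) e3 = a"
  using herm_frame_vec[of a b c d 1 0 0 0] herm_frame_vec[of a b c d 0 0 0 1]
  by (simp_all add: frame_vec_basis del: herm_frame_vec)

lemma frame_vec_eq_0_iff: "frame_vec a b c d = 0 \<longleftrightarrow> a = 0 \<and> b = 0 \<and> c = 0 \<and> d = 0"
proof
  assume zero: "frame_vec a b c d = 0"
  have "herm q (frame_vec a b c d) (frame_vec a' b' c' d') = 0" for a' b' c' d'
    unfolding zero by simp
  from this[of 0 0 0 1] this[of 0 0 1 0] this[of 0 1 0 0] this[of 1 0 0 0]
  show "a = 0 \<and> b = 0 \<and> c = 0 \<and> d = 0"
    by simp
qed (simp add: frame_vec_def)

lemma frame_vec_eq_iff [simp]: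
  "frame_vec a b c d = frame_vec a' b' c' d' \<longleftrightarrow> a = a' \<and> b = b' \<and> c = c' \<and> d = d'"
proof -
  have "frame_vec a b c d = frame_vec a' b' c' d' \<longleftrightarrow> frame_vec a b c d - frame_vec a' b' c' d' = 0"
    by (rule eq_iff_diff_eq_0)
  then show ?thesis
    by (simp add: frame_vec_diff frame_vec_eq_0_iff)
qed

text \<open>
  The coordinates with respect to the frame are unique by nondegeneracy, and counting gives existence.
\<close>
lemma frame_vec_cases:
  obtains a b c d where "v = frame_vec a b c d"
proof -
  have "inj (\<lambda>v::'a ^ 4. frame_vec (v $ 0) (v $ 1) (v $ 2) (v $ 3))"
  proof (rule injI)
    fix v w :: "'a ^ 4"
    assume "frame_vec (v $ 0) (v $ 1) (v $ 2) (v $ 3) = frame_vec (w $ 0) (w $ 1) (w $ 2) (w $ 3)"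
    then show "v = w"
      unfolding frame_vec_eq_iff by (rule vec4_eq_iff[THEN iffD2])
  qed
  then have "surj (\<lambda>v::'a ^ 4. frame_vec (v $ 0) (v $ 1) (v $ 2) (v $ 3))"
    by (rule finite_UNIV_inj_surj[OF finite])
  then show ?thesis
    using that unfolding surj_def by blast
qed

end

text \<open>
  Scaling gives \<open>e0\<close> and \<open>e3\<close>; \<open>e2\<close> is the intersection of \<open>l\<close> with the hyperplane orthogonal to
  \<open>Q\<close>.  For \<open>e1\<close>, project a vector that is not orthogonal to \<open>e2\<close> to the complement of
  \<open>\<langle>e0, e3\<rangle>\<close>, scale it, and add the multiple of \<open>e2\<close> that makes it isotropic, which involves
  a division by 2.
\<close>
lemma (in conjugation_field) obtain_hyperbolic_frame:
  assumes P: "P \<in> herm_surface q" and Q: "Q \<in> herm_surface q" and PQ: "\<not> herm_collinear q Q P"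
    and l: "totally_isotropic_line q l" and Pl: "P \<subseteq> l"
  obtains e0 e1 e2 e3 where "hyperbolic_frame q cj e0 e1 e2 e3"
    "P = vec.span {e3}" "Q = vec.span {e0}" "l = vec.span {e2, e3}"
proof -
  obtain e3 where e3: "e3 \<noteq> 0" "herm q e3 e3 = 0" "P = vec.span {e3}"
    using P by (auto simp: herm_surface_iff)
  obtain w where w: "w \<noteq> 0" "herm q w w = 0" "Q = vec.span {w}"
    using Q by (auto simp: herm_surface_iff)
  have we3: "herm q w e3 \<noteq> 0"
    using PQ by (simp add: e3 w herm_collinear_span)
  define e0 where "e0 = (1 / herm q w e3) *s w"
  have e0: "Q = vec.span {e0}" "herm q e0 e0 = 0" "herm q e0 e3 = 1"
    using we3 w by (simp_all add: e0_def span_singleton_scale)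
  then have e30: "herm q e3 e0 = 1"
    by (simp add: herm_sym[of e3 e0])
  have l_line: "vec.subspace l" "vec.dim l = 2"
    using l by (simp_all add: totally_isotropic_line_def is_line_def)
  have e3l: "e3 \<in> l"
    using Pl e3 by (auto simp: vec.span_base)
  obtain m where m: "m \<in> l" "m \<notin> vec.span {e3}"
  proof -
    have "\<not> l \<subseteq> vec.span {e3}"
      using vec.dim_le_card[of l "{e3}"] l_line(2) by auto
    then show ?thesis
      using that by blast
  qed
  define e2 where "e2 = m - herm q m e0 *s e3"
  have e2l: "e2 \<in> l"
    using m e3l l_line by (simp add: e2_def vec.subspace_diff vec.subspace_scale)
  have e2_notin: "e2 \<notin> vec.span {e3}"
  proof
    assume "e2 \<in> vec.span {e3}"
    then have "e2 + herm q m e0 *s e3 \<in> vec.span {e3}"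
      by (intro vec.span_add vec.span_scale) (auto simp: vec.span_base)
    then show False
      using m by (simp add: e2_def)
  qed
  then have e2_neq: "e2 \<noteq> 0" "e2 \<noteq> e3"
    by (auto simp: vec.span_zero vec.span_base)
  have l_span: "l = vec.span {e2, e3}"
  proof
    have "vec.independent {e2, e3}"
      using e2_notin e3 by (simp add: vec.independent_insert)
    then show "l \<subseteq> vec.span {e2, e3}"
      using e2_neq l_line e2l e3l by (intro vec.card_ge_dim_independent) auto
    show "vec.span {e2, e3} \<subseteq> l"
      using l_line e2l e3l by (intro vec.span_minimal) auto
  qed
  have h2: "herm q e2 e2 = 0" "herm q e2 e3 = 0" "herm q e3 e2 = 0"
    using totally_isotropic_orthogonal[OF l] e2l e3l by auto
  have h20: "herm q e2 e0 = 0"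
    by (simp add: e2_def e30)
  then have h02: "herm q e0 e2 = 0"
    by (simp add: herm_eq_0_sym)
  obtain z where z: "herm q z e2 \<noteq> 0"
    using herm_nondegenerate e2_neq by blast
  define y where "y = z - herm q z e0 *s e3 - herm q z e3 *s e0"
  have y: "herm q y e0 = 0" "herm q y e3 = 0" "herm q y e2 = herm q z e2"
    by (simp_all add: y_def e0 e3 e30 h2 h02)
  define y' where "y' = (- 1 / herm q z e2) *s y"
  have y': "herm q y' e0 = 0" "herm q y' e3 = 0" "herm q y' e2 = - 1"
    using z by (simp_all add: y'_def y)
  then have y'2: "herm q e2 y' = - 1"
    by (simp add: herm_sym[of e2 y'])
  define e1 where "e1 = y' + (herm q y' y' / 2) *s e2"
  have "cj (herm q y' y') = herm q y' y'"
    by (metis herm_sym)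
  then have "herm q e1 e1 = 0"
    using two_neq_0 by (simp add: e1_def y' y'2 h2 field_simps)
  moreover have "herm q e1 e0 = 0" "herm q e1 e3 = 0" "herm q e1 e2 = - 1"
    by (simp_all add: e1_def y' h2 h20)
  ultimately have "hyperbolic_frame q cj e0 e1 e2 e3"
    by unfold_locales (simp_all add: e0 e3 h2 h02 herm_eq_0_sym[of e0 e1])
  then show ?thesis
    using that e3 e0 l_span by blast
qed

section \<open>Point sets given by a graph\<close>

context hyperbolic_frame
begin

text \<open>
  The parameter of the point of \<open>l\<close> is \<open>cj u\<close>, because the form is conjugate-linear in its second
  argument: \<open>\<langle>0, 0, 1, t\<rangle>\<close> and \<open>\<langle>1, u, v, w\<rangle>\<close> are collinear iff \<open>t = cj u\<close>.
\<close>
lemma obtain_graph: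
  assumes S: "S \<subseteq> herm_surface q" "pairwise_noncollinear q S" "vec.span {e3} \<in> S"
    and uniq: "\<forall>Y \<in> herm_surface q. Y \<subseteq> vec.span {e2, e3} \<and> Y \<noteq> vec.span {e3} \<longrightarrow>
      (\<exists>!Z. Z \<in> S - {vec.span {e3}} \<and> herm_collinear q Y Z)"
  obtains f c where "S = insert (vec.span {e3}) (range (\<lambda>u. vec.span {frame_vec 1 u (f u) (c u)}))"
    "\<And>u. corr q S (vec.span {e3}) (vec.span {frame_vec 0 0 1 (cj u)})
      = vec.span {frame_vec 1 u (f u) (c u)}"
proof -
  let ?P = "vec.span {e3}"
  define Y where "Y u = vec.span {frame_vec 0 0 1 (cj u)}" for u
  have affine: "\<exists>a b c. Z = vec.span {frame_vec 1 a b c}" if "Z \<in> S" "Z \<noteq> ?P" for Z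
  proof -
    have "Z \<in> herm_surface q"
      using that S(1) by blast
    then obtain v where v: "Z = vec.span {v}"
      unfolding herm_surface_iff by blast
    obtain a b c d where abcd: "v = frame_vec a b c d"
      using frame_vec_cases .
    have "\<not> herm_collinear q Z ?P"
      using that S(2,3) unfolding pairwise_noncollinear_def pairwise_def by blast
    then have "herm q v (frame_vec 0 0 0 1) \<noteq> 0"
      by (simp add: v herm_collinear_span frame_vec_basis)
    then have "a \<noteq> 0"
      by (simp add: abcd)
    have "v = a *s frame_vec 1 (b / a) (c / a) (d / a)"
      using \<open>a \<noteq> 0\<close> by (simp add: abcd frame_vec_scale)
    then have "Z = vec.span {frame_vec 1 (b / a) (c / a) (d / a)}"
      unfolding v using \<open>a \<noteq> 0\<close> by (simp only: span_singleton_scale not_False_eq_True)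
    then show ?thesis
      by blast
  qed
  have not_P: "vec.span {frame_vec 1 a b c} \<noteq> ?P" for a b c
  proof
    assume "vec.span {frame_vec 1 a b c} = ?P"
    then have "frame_vec 1 a b c \<in> vec.span {frame_vec 0 0 0 1}"
      by (metis frame_vec_basis(4) singletonI vec.span_base)
    then show False
      by (auto simp: in_span_singleton_iff frame_vec_scale)
  qed
  have Y_ne: "Y u \<noteq> ?P" for u
  proof
    assume "Y u = ?P"
    then have "frame_vec 0 0 1 (cj u) \<in> vec.span {frame_vec 0 0 0 1}"
      unfolding Y_def by (metis frame_vec_basis(4) singletonI vec.span_base)
    then show False
      by (auto simp: in_span_singleton_iff frame_vec_scale)
  qed
  have Y_surface: "Y u \<in> herm_surface q" for u
    unfolding herm_surface_iff Y_def
    by (intro exI[of _ "frame_vec 0 0 1 (cj u)"]) (simp add: frame_vec_eq_0_iff)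
  have Y_line: "Y u \<subseteq> vec.span {e2, e3}" for u
  proof -
    have "frame_vec 0 0 1 (cj u) \<in> vec.span {e2, e3}"
      by (simp add: frame_vec_def vec.span_add vec.span_scale vec.span_base)
    then show ?thesis
      unfolding Y_def by (intro vec.span_minimal) auto
  qed
  have ex1: "\<exists>!Z. Z \<in> S - {?P} \<and> herm_collinear q (Y u) Z" for u
    by (rule uniq[rule_format, OF Y_surface conjI[OF Y_line Y_ne]])
  have collinear: "herm_collinear q (Y u) (vec.span {frame_vec 1 a b c}) \<longleftrightarrow> a = u" for u a b c
  proof -
    have "herm_collinear q (Y u) (vec.span {frame_vec 1 a b c}) \<longleftrightarrow> cj (u - a) = 0"
      unfolding Y_def herm_collinear_span by simp
    then show ?thesis
      unfolding cj_eq_0_iff by auto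
  qed
  have "\<exists>b c. vec.span {frame_vec 1 u b c} \<in> S" for u
  proof -
    obtain Z where Z: "Z \<in> S" "Z \<noteq> ?P" "herm_collinear q (Y u) Z"
      using ex1_implies_ex[OF ex1[of u]] by blast
    then obtain a b c where abc: "Z = vec.span {frame_vec 1 a b c}"
      using affine by blast
    then have "a = u"
      using Z(3) collinear by simp
    then show ?thesis
      using Z(1) abc by blast
  qed
  then obtain f c where fc: "vec.span {frame_vec 1 u (f u) (c u)} \<in> S" for u
    by metis
  have eq: "Z = vec.span {frame_vec 1 u (f u) (c u)}" if "Z \<in> S" "Z \<noteq> ?P" "herm_collinear q (Y u) Z" for Z u
  proof (rule ex1E[OF ex1[of u]])
    fix W assume "\<forall>Z. Z \<in> S - {?P} \<and> herm_collinear q (Y u) Z \<longrightarrow> Z = W"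
    moreover have "herm_collinear q (Y u) (vec.span {frame_vec 1 u (f u) (c u)})"
      using collinear by blast
    ultimately show ?thesis
      using that fc[of u] not_P by blast
  qed
  show ?thesis
  proof
    show "S = insert ?P (range (\<lambda>u. vec.span {frame_vec 1 u (f u) (c u)}))"
    proof (intro equalityI subsetI)
      fix Z assume Z: "Z \<in> S"
      show "Z \<in> insert ?P (range (\<lambda>u. vec.span {frame_vec 1 u (f u) (c u)}))"
      proof (cases "Z = ?P")
        case False
        then obtain a b d where "Z = vec.span {frame_vec 1 a b d}"
          using affine Z by blast
        then have "Z = vec.span {frame_vec 1 a (f a) (c a)}"
          using eq Z False collinear by blast
        then show ?thesis
          by blast
      qed simp
    qed (use S fc in auto)
    show "corr q S ?P (vec.span {frame_vec 0 0 1 (cj u)}) = vec.span {frame_vec 1 u (f u) (c u)}" for u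
    proof -
      have "(THE Z. Z \<in> S - {?P} \<and> herm_collinear q (Y u) Z) = vec.span {frame_vec 1 u (f u) (c u)}"
        using fc not_P collinear eq by (intro the_equality) auto
      then show ?thesis
        using Y_ne[of u] by (simp add: corr_def Y_def)
    qed
  qed
qed

text \<open>
  The Baer subline consists of \<open>\<langle>e3\<rangle>\<close> and the points with parameters \<open>u + r * v\<close>, \<open>r\<close> in the
  subfield.  Modulo \<open>e3\<close>, the affine dependency between the points with \<open>r = 0, 1, s\<close> leaves \<open>\<delta> * e2\<close>
  in the plane, where \<open>\<delta>\<close> is the deviation of \<open>f\<close> from an affine map.  If \<open>\<delta>\<close> were nonzero, the plane would contain \<open>e2\<close>,
  then \<open>e1\<close> and \<open>e0\<close>, hence be the whole space.
\<close>
lemma baer_planes_imp_affine: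
  assumes baer: "\<forall>b. baer_subline q (vec.span {e2, e3}) b \<and> vec.span {e3} \<in> b \<longrightarrow>
      (\<exists>E. is_plane E \<and> vec.span {e3} \<subseteq> E \<and> (\<forall>R \<in> corr q S (vec.span {e3}) ` b. R \<subseteq> E))"
    and corr: "\<And>u. corr q S (vec.span {e3}) (vec.span {frame_vec 0 0 1 (cj u)})
      = vec.span {frame_vec 1 u (f u) (c u)}"
    and s: "cj s = s"
  shows "f (u + s * v) = (1 - s) * f u + s * f (u + v)"
proof (cases "v = 0")
  case True
  then show ?thesis
    by (simp add: algebra_simps)
next
  case False
  let ?A = "frame_vec 0 0 1 (cj u)" and ?B = "frame_vec 0 0 0 (cj v)"
  define b where "b = {vec.span {c *s ?A + d *s ?B} | c d.
    c \<in> subfield_q q \<and> d \<in> subfield_q q \<and> (c, d) \<noteq> (0, 0)}"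
  have "vec.independent {?A, ?B}"
    using False
    by (auto simp: vec.independent_insert in_span_singleton_iff frame_vec_scale frame_vec_eq_0_iff)
  moreover have "vec.span {?A, ?B} = vec.span {e2, e3}"
  proof
    show "vec.span {?A, ?B} \<subseteq> vec.span {e2, e3}"
      by (intro vec.span_minimal)
        (auto simp: frame_vec_def vec.span_add vec.span_scale vec.span_base)
    have "frame_vec 0 0 0 1 = (1 / cj v) *s ?B" "frame_vec 0 0 1 0 = ?A - (cj u / cj v) *s ?B"
      using False by (simp_all add: frame_vec_scale frame_vec_diff)
    moreover have "(1 / cj v) *s ?B \<in> vec.span {?A, ?B}" "?A - (cj u / cj v) *s ?B \<in> vec.span {?A, ?B}"
      by (intro vec.span_diff vec.span_scale vec.span_base; simp)+
    ultimately have "e3 \<in> vec.span {?A, ?B}" "e2 \<in> vec.span {?A, ?B}"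
      by (simp_all only: frame_vec_basis)
    then show "vec.span {e2, e3} \<subseteq> vec.span {?A, ?B}"
      by (intro vec.span_minimal) auto
  qed
  ultimately have "baer_subline q (vec.span {e2, e3}) b"
    unfolding baer_subline_def b_def by (intro exI[of _ ?A] exI[of _ ?B]) simp
  moreover have "vec.span {e3} \<in> b"
  proof -
    have "vec.span {0 *s ?A + 1 *s ?B} = vec.span {cj v *s e3}"
      by (simp add: frame_vec_def)
    also have "\<dots> = vec.span {e3}"
      using False by (simp add: span_singleton_scale)
    finally show ?thesis
      unfolding b_def mem_Collect_eq
      by (intro exI[of _ 0] exI[of _ 1]) (simp add: subfield_iff)
  qed
  ultimately obtain E where E: "is_plane E" "vec.span {e3} \<subseteq> E"
      "\<And>R. R \<in> corr q S (vec.span {e3}) ` b \<Longrightarrow> R \<subseteq> E"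
    using baer by meson
  have sub: "vec.subspace E"
    using E by (simp add: is_plane_def)
  have e3: "frame_vec 0 0 0 1 \<in> E"
    using E(2) by (auto simp: vec.span_base frame_vec_basis)
  have in_E: "frame_vec 1 (u + r * v) (f (u + r * v)) 0 \<in> E" if "cj r = r" for r
  proof -
    have "vec.span {1 *s ?A + r *s ?B} \<in> b"
      unfolding b_def mem_Collect_eq using that
      by (intro exI[of _ 1] exI[of _ r]) (simp add: subfield_iff)
    moreover have "1 *s ?A + r *s ?B = frame_vec 0 0 1 (cj (u + r * v))"
      using that by (simp add: frame_vec_scale frame_vec_add)
    ultimately have "vec.span {frame_vec 1 (u + r * v) (f (u + r * v)) (c (u + r * v))}
        \<in> corr q S (vec.span {e3}) ` b"
      using corr by (metis imageI)
    then have "frame_vec 1 (u + r * v) (f (u + r * v)) (c (u + r * v)) \<in> E"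
      using E(3) by (meson singletonI subsetD vec.span_base)
    then have "frame_vec 1 (u + r * v) (f (u + r * v)) (c (u + r * v)) - c (u + r * v) *s frame_vec 0 0 0 1 \<in> E"
      using e3 sub by (simp add: vec.subspace_diff vec.subspace_scale)
    then show ?thesis
      by (simp add: frame_vec_scale frame_vec_diff)
  qed
  define \<delta> where "\<delta> = f (u + s * v) - ((1 - s) * f u + s * f (u + v))"
  let ?g = "\<lambda>r. frame_vec 1 (u + r * v) (f (u + r * v)) 0"
  have g: "?g s \<in> E" "?g 0 \<in> E" "?g 1 \<in> E"
    using in_E[OF s] in_E[OF cj_0] in_E[OF cj_1] by simp_all
  have "?g s - ((1 - s) *s ?g 0 + s *s ?g 1) = frame_vec 0 0 \<delta> 0"
    by (simp add: \<delta>_def frame_vec_scale frame_vec_diff frame_vec_add algebra_simps)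
  then have \<delta>: "frame_vec 0 0 \<delta> 0 \<in> E"
    using g sub by (metis vec.subspace_add vec.subspace_diff vec.subspace_scale)
  have "\<delta> = 0"
  proof (rule ccontr)
    assume "\<delta> \<noteq> 0"
    then have "frame_vec 0 0 1 0 = (1 / \<delta>) *s frame_vec 0 0 \<delta> 0"
      by (simp add: frame_vec_scale)
    then have e2: "frame_vec 0 0 1 0 \<in> E"
      using \<delta> sub by (metis vec.subspace_scale)
    have "frame_vec 0 1 0 0 = (1 / v) *s (?g 1 - ?g 0 - (f (u + v) - f u) *s frame_vec 0 0 1 0)"
      using False by (simp add: frame_vec_scale frame_vec_diff)
    then have e1: "frame_vec 0 1 0 0 \<in> E"
      using g e2 sub by (metis vec.subspace_diff vec.subspace_scale)
    have "frame_vec 1 0 0 0 = ?g 0 - u *s frame_vec 0 1 0 0 - f u *s frame_vec 0 0 1 0"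
      by (simp add: frame_vec_scale frame_vec_diff)
    then have e0: "frame_vec 1 0 0 0 \<in> E"
      using g e1 e2 sub by (metis vec.subspace_diff vec.subspace_scale)
    have "x \<in> E" for x
    proof -
      obtain a b c d where "x = frame_vec a b c d"
        using frame_vec_cases .
      then show ?thesis
        using e0 e1 e2 e3 sub unfolding frame_vec_basis
        by (simp add: frame_vec_def vec.subspace_add vec.subspace_scale)
    qed
    then have "E = UNIV"
      by blast
    moreover have "vec.dim (UNIV :: ('a ^ 4) set) = 4"
      by (simp only: vec_dim_card) simp
    ultimately show False
      using E(1) unfolding is_plane_def by simp
  qed
  then show ?thesis
    by (simp add: \<delta>_def)
qed

text \<open>
  The three planes lie in the polars of \<open>\<langle>1, 0, 0, - cj c\<rangle>\<close>, \<open>\<langle>0, a, b, c\<rangle>\<close> and \<open>\<langle>1, a, b, 0\<rangle>\<close>, the points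
  where the sides of the triangle meet the polars of the opposite vertices.  These are dependent iff
  \<open>cj c = c\<close>; otherwise the planes meet in at most one point.
\<close>
lemma perspective_imp_real:
  assumes persp: "in_perspective q (vec.span {e3}) (vec.span {e0}) (vec.span {frame_vec 1 a b c})"
    and a: "a \<noteq> 0"
  shows "cj c = c"
proof (rule ccontr)
  assume c: "cj c \<noteq> c"
  let ?R = "frame_vec 1 a b c"
  let ?L = "vec.span ((perp q (vec.span {e3}) \<inter> perp q (vec.span {e0})) \<union> vec.span {?R}) \<inter>
    vec.span ((perp q (vec.span {e0}) \<inter> perp q (vec.span {?R})) \<union> vec.span {e3}) \<inter>
    vec.span ((perp q (vec.span {?R}) \<inter> perp q (vec.span {e3})) \<union> vec.span {e0})"
  have plane: "herm q x n = 0"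
    if "x \<in> vec.span ((perp q (vec.span {y}) \<inter> perp q (vec.span {z})) \<union> vec.span {w})"
      and "\<And>v. herm q v y = 0 \<Longrightarrow> herm q v z = 0 \<Longrightarrow> herm q v n = 0" and "herm q w n = 0"
    for x n y z w :: "'a ^ 4"
    using that(1)
  proof (induction rule: vec.span_induct)
    show "vec.subspace {x. herm q x n = 0}"
      by (auto simp: vec.subspace_def)
    fix x assume "x \<in> (perp q (vec.span {y}) \<inter> perp q (vec.span {z})) \<union> vec.span {w}"
    then consider "x \<in> perp q (vec.span {y})" "x \<in> perp q (vec.span {z})" | k where "x = k *s w"
      by (auto simp: in_span_singleton_iff)
    then show "herm q x n = 0"
    proof cases
      case 1
      then have "herm q y x = 0" "herm q z x = 0"
        by (auto simp: perp_def vec.span_base)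
      then show ?thesis
        using that(2) herm_eq_0_sym by blast
    qed (use that(3) in simp)
  qed
  have "?L \<subseteq> vec.span {frame_vec 0 1 (- cj b / cj a) 0}"
  proof
    fix x assume x: "x \<in> ?L"
    obtain x0 x1 x2 x3 where x_eq: "x = frame_vec x0 x1 x2 x3"
      using frame_vec_cases .
    have 1: "herm q x (frame_vec 1 0 0 (- cj c)) = 0"
    proof (rule plane[of _ e3 e0 ?R])
      fix v assume "herm q v e3 = 0" "herm q v e0 = 0"
      moreover obtain v0 v1 v2 v3 where "v = frame_vec v0 v1 v2 v3"
        using frame_vec_cases .
      ultimately show "herm q v (frame_vec 1 0 0 (- cj c)) = 0"
        by (simp add: herm_frame_vec_basis)
    qed (use x in simp_all)
    have 2: "herm q x (frame_vec 0 a b c) = 0"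
    proof (rule plane[of _ e0 ?R e3])
      fix v assume "herm q v e0 = 0" "herm q v ?R = 0"
      moreover obtain v0 v1 v2 v3 where "v = frame_vec v0 v1 v2 v3"
        using frame_vec_cases .
      ultimately show "herm q v (frame_vec 0 a b c) = 0"
        by (simp add: herm_frame_vec_basis)
    qed (use x herm_frame_vec[of 0 0 0 1] herm_frame_vec[of 1 0 0 0] in
        \<open>simp_all add: frame_vec_basis del: herm_frame_vec\<close>)
    have 3: "herm q x (frame_vec 1 a b 0) = 0"
    proof (rule plane[of _ ?R e3 e0])
      fix v assume "herm q v ?R = 0" "herm q v e3 = 0"
      moreover obtain v0 v1 v2 v3 where "v = frame_vec v0 v1 v2 v3"
        using frame_vec_cases .
      ultimately show "herm q v (frame_vec 1 a b 0) = 0"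
        by (simp add: herm_frame_vec_basis)
    qed (use x herm_frame_vec[of 0 0 0 1] herm_frame_vec[of 1 0 0 0] in
        \<open>simp_all add: frame_vec_basis del: herm_frame_vec\<close>)
    have "x0 * (cj c - c) = 0"
      using 1 2 3 by (simp add: x_eq algebra_simps)
    then have x0: "x0 = 0" "x3 = 0"
      using c 1 by (simp_all add: x_eq)
    then have "x2 = x1 * (- cj b / cj a)"
      using 3 a by (simp add: x_eq field_simps)
    then have "x = x1 *s frame_vec 0 1 (- cj b / cj a) 0"
      by (simp add: x_eq x0 frame_vec_scale)
    then show "x \<in> vec.span {frame_vec 0 1 (- cj b / cj a) 0}"
      by (auto simp: in_span_singleton_iff)
  qed
  then have "vec.dim ?L \<le> 1"
    using vec.dim_le_card[of ?L "{frame_vec 0 1 (- cj b / cj a) 0}"] by simp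
  then show False
    using persp by (simp add: in_perspective_def is_line_def)
qed

text \<open>
  The Veronesean is the graph of \<open>cj\<close> with last coordinate the norm.  The substitution
  \<open>u = g x = \<kappa> * x + cj x\<close> makes \<open>c\<close> a multiple \<open>\<nu>\<close> of the norm, and \<open>g x\<close>, \<open>f (g x)\<close> are \<open>K\<close>-linear in
  \<open>x\<close> and \<open>cj x\<close>.  The same linear expressions in two independent variables define a linear map of
  the whole space, and the equation for \<open>\<kappa>\<close> together with \<open>\<alpha> + cj \<alpha> = 0\<close> says that it is a similitude
  with multiplier \<open>\<nu>\<close>.
\<close>
lemma graph_equivalent_veronesean:
  assumes f: "\<And>u. f u = \<alpha> * u + \<beta> * cj u" and \<alpha>: "\<alpha> + cj \<alpha> = 0"
    and c: "\<And>u. 2 * c u = binary_form 0 \<beta> u"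
    and anis: "\<And>u. u \<noteq> 0 \<Longrightarrow> binary_form 0 \<beta> u \<noteq> 0"
    and S: "S = insert (vec.span {e3}) (range (\<lambda>u. vec.span {frame_vec 1 u (f u) (c u)}))"
  shows "herm_equivalent q S (herm_veronesean q)"
proof -
  obtain \<kappa> \<mu> where \<kappa>: "cj \<beta> * \<kappa>\<^sup>2 + 0 * \<kappa> + \<beta> = 0"
    and \<mu>: "\<mu> = 0 * (\<kappa> * cj \<kappa> + 1) + 2 * (\<beta> * cj \<kappa> + cj \<beta> * \<kappa>)"
    and form: "\<And>x. binary_form 0 \<beta> (\<kappa> * x + cj x) = \<mu> * (x * cj x)" and \<mu>0: "\<mu> \<noteq> 0"
    using anisotropic_similar_norm[of 0 \<beta>] anis cj_0 by metis
  define \<nu> where "\<nu> = \<beta> * cj \<kappa> + cj \<beta> * \<kappa>"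
  have "\<mu> = 2 * \<nu>"
    by (simp add: \<mu> \<nu>_def algebra_simps)
  moreover have "cj \<nu> = \<nu>"
    by (simp add: \<nu>_def)
  ultimately have \<nu>: "\<nu> \<noteq> 0" "cj \<nu> = \<nu>" "\<mu> = 2 * \<nu>"
    using \<mu>0 by auto
  define g where "g x = \<kappa> * x + cj x" for x
  have g_diff: "g (x - y) = g x - g y" for x y
    by (simp add: g_def algebra_simps)
  have "x = 0" if "g x = 0" for x
  proof -
    have "binary_form 0 \<beta> (g x) = \<mu> * (x * cj x)"
      by (simp only: g_def form)
    then show ?thesis
      unfolding that using \<mu>0 by (simp add: binary_form_def)
  qed
  then have "inj g"
    by (intro injI) (metis g_diff eq_iff_diff_eq_0)
  then have "surj g"
    by (simp add: finite_UNIV_inj_surj)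
  have fg: "f (g x) = (\<alpha> * \<kappa> + \<beta>) * x + (\<alpha> + \<beta> * cj \<kappa>) * cj x" for x
    by (simp add: f g_def algebra_simps)
  have cg: "c (g x) = \<nu> * (x * cj x)" for x
  proof -
    have "2 * c (g x) = 2 * (\<nu> * (x * cj x))"
      using c[of "g x"] form[of x] by (simp add: g_def \<nu>)
    then show ?thesis
      using two_neq_0 mult_left_cancel by blast
  qed
  define \<phi> where "\<phi> X = frame_vec (X $ 0) (\<kappa> * X $ 1 + X $ 2)
    ((\<alpha> * \<kappa> + \<beta>) * X $ 1 + (\<alpha> + \<beta> * cj \<kappa>) * X $ 2) (\<nu> * X $ 3)" for X :: "'a ^ 4"
  have scale: "\<phi> (k *s X) = k *s \<phi> X" for k X
    by (simp add: \<phi>_def frame_vec_scale algebra_simps)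
  have span: "\<phi> ` vec.span {v} = vec.span {\<phi> v}" for v
    by (auto simp: vec.span_singleton scale image_iff simp del: frame_vec_eq_iff)
  have ca: "cj \<alpha> = - \<alpha>"
    using \<alpha> by (simp add: eq_neg_iff_add_eq_0 add.commute)
  have root: "cj \<beta> * \<kappa>\<^sup>2 = - \<beta>" "\<beta> * (cj \<kappa>)\<^sup>2 = - cj \<beta>"
  proof -
    show "cj \<beta> * \<kappa>\<^sup>2 = - \<beta>"
      using \<kappa> by (simp add: eq_neg_iff_add_eq_0)
    from arg_cong[OF this, of cj] show "\<beta> * (cj \<kappa>)\<^sup>2 = - cj \<beta>"
      by simp
  qed
  have "herm q (\<phi> X) (\<phi> Y) = \<nu> * herm q X Y" for X Y
  proof -
    have "herm q (\<phi> X) (\<phi> Y) = \<nu> * (X $ 0 * cj (Y $ 3) + X $ 3 * cj (Y $ 0))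
      - \<nu> * (X $ 1 * cj (Y $ 1) + X $ 2 * cj (Y $ 2))
      - (cj \<beta> * \<kappa>\<^sup>2 + \<beta>) * (X $ 1 * cj (Y $ 2)) - (\<beta> * (cj \<kappa>)\<^sup>2 + cj \<beta>) * (X $ 2 * cj (Y $ 1))"
      unfolding \<phi>_def herm_frame_vec by (simp add: ca \<nu>(2)) (simp add: \<nu>_def algebra_simps power2_eq_square)
    then show ?thesis
      by (simp add: root herm_cj algebra_simps)
  qed
  moreover have "\<phi> (X + Y) = \<phi> X + \<phi> Y" for X Y
    by (simp add: \<phi>_def frame_vec_add algebra_simps)
  moreover have "(\<lambda>A. \<phi> ` A) ` herm_veronesean q = S"
  proof -
    have "\<phi> (coords 1 x (x ^ q) (x ^ (q + 1))) = frame_vec 1 (g x) (f (g x)) (c (g x))" for x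
      by (simp add: \<phi>_def g_def[symmetric] fg cg cj_power[symmetric])
    moreover have "vec.span {\<phi> (coords 0 0 0 1)} = vec.span {e3}"
    proof -
      have "\<phi> (coords 0 0 0 1) = \<nu> *s e3"
        by (simp add: \<phi>_def frame_vec_def)
      then show ?thesis
        using \<nu> by (simp add: span_singleton_scale)
    qed
    moreover have "herm_veronesean q
      = insert (vec.span {coords 0 0 0 1}) (range (\<lambda>x::'a. vec.span {coords 1 x (x ^ q) (x ^ (q + 1))}))"
      by (auto simp: herm_veronesean_def)
    ultimately have "(\<lambda>A. \<phi> ` A) ` herm_veronesean q
      = insert (vec.span {e3}) (range (\<lambda>x. vec.span {frame_vec 1 (g x) (f (g x)) (c (g x))}))"
      by (simp add: image_image span del: power_Suc)
    also have "range (\<lambda>x. vec.span {frame_vec 1 (g x) (f (g x)) (c (g x))})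
      = (\<lambda>u. vec.span {frame_vec 1 u (f u) (c u)}) ` range g"
      by (simp only: image_image)
    finally show ?thesis
      unfolding S \<open>surj g\<close> .
  qed
  ultimately show ?thesis
    using scale \<nu>(1) by (intro herm_equivalent_by_similitude)
qed

lemma equivalent_veronesean:
  assumes S: "S \<subseteq> herm_surface q" "pairwise_noncollinear q S"
    and P: "vec.span {e3} \<in> S"
    and uniq: "\<forall>Y \<in> herm_surface q. Y \<subseteq> vec.span {e2, e3} \<and> Y \<noteq> vec.span {e3} \<longrightarrow>
      (\<exists>!Z. Z \<in> S - {vec.span {e3}} \<and> herm_collinear q Y Z)"
    and baer: "\<forall>b. baer_subline q (vec.span {e2, e3}) b \<and> vec.span {e3} \<in> b \<longrightarrow>
      (\<exists>E. is_plane E \<and> vec.span {e3} \<subseteq> E \<and> (\<forall>R \<in> corr q S (vec.span {e3}) ` b. R \<subseteq> E))"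
    and Q: "vec.span {e0} \<in> S"
    and persp: "\<forall>R \<in> S. R \<noteq> vec.span {e3} \<and> R \<noteq> vec.span {e0} \<longrightarrow>
      in_perspective q (vec.span {e3}) (vec.span {e0}) R"
    and nondeg: "\<forall>R1 \<in> S. \<forall>R2 \<in> S. \<forall>R3 \<in> S. R1 \<noteq> R2 \<and> R1 \<noteq> R3 \<and> R2 \<noteq> R3 \<longrightarrow>
      nondegenerate_plane q (vec.span (R1 \<union> R2 \<union> R3))"
  shows "herm_equivalent q S (herm_veronesean q)"
proof -
  obtain f c where S_eq: "S = insert (vec.span {e3}) (range (\<lambda>u. vec.span {frame_vec 1 u (f u) (c u)}))"
    and corr: "\<And>u. corr q S (vec.span {e3}) (vec.span {frame_vec 0 0 1 (cj u)})
      = vec.span {frame_vec 1 u (f u) (c u)}"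
    using obtain_graph[OF S P uniq] by blast
  define V where "V u = frame_vec 1 u (f u) (c u)" for u
  have V_S: "vec.span {V u} \<in> S" for u
    by (simp add: S_eq V_def)
  have V_span_eq: "vec.span {V u} = vec.span {frame_vec a x y z} \<Longrightarrow>
      \<exists>k. a = k \<and> x = k * u \<and> y = k * f u \<and> z = k * c u" for u a x y z
  proof -
    assume "vec.span {V u} = vec.span {frame_vec a x y z}"
    then have "frame_vec a x y z \<in> vec.span {V u}"
      by (metis singletonI vec.span_base)
    then show ?thesis
      by (auto simp: in_span_singleton_iff V_def frame_vec_scale)
  qed
  have V_ne_P: "vec.span {V u} \<noteq> vec.span {e3}" for u
    using V_span_eq[of u 0 0 0 1] by (auto simp: frame_vec_basis)
  have V_inj: "vec.span {V u} = vec.span {V v} \<Longrightarrow> u = v" for u v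
    using V_span_eq[of u 1 v "f v" "c v"] by (auto simp: V_def)
  have noncoll: "herm q (V u) (V v) \<noteq> 0" if "u \<noteq> v" for u v
  proof -
    have "vec.span {V u} \<noteq> vec.span {V v}"
      using that V_inj by blast
    then have "\<not> herm_collinear q (vec.span {V u}) (vec.span {V v})"
      by (rule pairwiseD[OF S(2)[unfolded pairwise_noncollinear_def] V_S V_S])
    then show ?thesis
      by (simp add: herm_collinear_span)
  qed
  have isotropic: "herm q (V u) (V u) = 0" for u
    using subsetD[OF S(1) V_S[of u]] by (simp add: herm_surface_def vec.span_base)
  have "vec.span {e0} \<noteq> vec.span {e3}"
  proof
    assume "vec.span {e0} = vec.span {e3}"
    then have "e0 \<in> vec.span {e3}"
      by (metis singletonI vec.span_base)
    then have "frame_vec 1 0 0 0 \<in> vec.span {frame_vec 0 0 0 1}"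
      by (simp only: frame_vec_basis)
    then show False
      by (auto simp: in_span_singleton_iff frame_vec_scale)
  qed
  then obtain z where "vec.span {V z} = vec.span {e0}"
    using Q by (auto simp: S_eq V_def)
  then have V0: "vec.span {V 0} = vec.span {e0}" and f0: "f 0 = 0" and c0: "c 0 = 0"
    using V_span_eq[of z 1 0 0 0] by (auto simp: frame_vec_basis)
  have V0_eq: "V 0 = e0"
    by (simp add: V_def f0 c0 frame_vec_basis)
  have affine: "f (u + s * v) = (1 - s) * f u + s * f (u + v)" if "cj s = s" for u v s
    using baer_planes_imp_affine[OF baer corr that] .
  have f_scale: "f (s * v) = s * f v" if "cj s = s" for s v
    using affine[OF that, of 0 v] by (simp add: f0)
  \<comment> \<open>The affine law at the midpoint of \<open>2 * u\<close> and \<open>2 * v\<close>.\<close>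
  have f_add: "f (u + v) = f u + f v" for u v
  proof -
    have half: "cj (1 / 2) = 1 / 2"
      by simp
    have sum: "(1/2) * x + (1/2) * x = x" for x :: 'a
      by (simp add: field_simps flip: mult_2)
    have mid: "f (2 * u + (1/2) * (2 * v - 2 * u)) = (1 - 1/2) * f (2 * u) + (1/2) * f (2 * v)"
      using affine[OF half, of "2 * u" "2 * v - 2 * u"] by simp
    have arg: "2 * u + (1/2) * (2 * v - 2 * u) = u + v"
      by (simp add: field_simps)
    have "(1 - 1/2 :: 'a) = 1/2"
      using sum[of 1] by (simp add: algebra_simps)
    then show ?thesis
      using mid unfolding arg by (simp add: f_scale[OF cj_2])
  qed
  obtain \<alpha> \<beta> where f: "\<And>u. f u = \<alpha> * u + \<beta> * cj u"
    using real_linear_form[of f, OF f_add f_scale] by blast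
  define T where "T = \<alpha> + cj \<alpha>"
  have cT: "cj T = T"
    by (simp add: T_def add.commute)
  have c_real: "cj (c u) = c u" for u
  proof (cases "u = 0")
    case False
    then have "vec.span {V u} \<noteq> vec.span {e0}"
      using V_inj V0 by metis
    then have "in_perspective q (vec.span {e3}) (vec.span {e0}) (vec.span {V u})"
      using persp V_S[of u] V_ne_P[of u] by simp
    then show ?thesis
      unfolding V_def using False by (rule perspective_imp_real)
  qed (simp add: c0)
  have c: "2 * c u = binary_form T \<beta> u" for u
    using isotropic[of u] c_real[of u]
    by (simp add: V_def binary_form_def T_def f algebra_simps power2_eq_square)
  have anis: "binary_form T \<beta> u \<noteq> 0" if "u \<noteq> 0" for u
  proof -
    have "c u \<noteq> 0"
      using noncoll[OF that] unfolding V0_eq by (simp add: V_def herm_frame_vec_basis)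
    then show ?thesis
      by (simp flip: c)
  qed
  \<comment> \<open>Splitting into the part fixed by \<open>cj\<close>, the polarisation of \<open>c\<close>, and the part that \<open>cj\<close> negates.\<close>
  have herm_V: "2 * herm q (V u) (V v) = binary_form T \<beta> (u - v) + T * alt_form u v" for u v
  proof -
    have "2 * herm q (V u) (V v)
      = 2 * c u + 2 * c v - 2 * (u * cj (f v) + f u * cj v)"
      by (simp add: V_def c_real algebra_simps)
    also have "\<dots> = binary_form T \<beta> (u - v) + T * alt_form u v"
      unfolding c by (simp add: binary_form_def alt_form_def T_def f algebra_simps power2_eq_square)
    finally show ?thesis .
  qed
  have "T = 0"
  proof (rule ccontr)
    assume "T \<noteq> 0"
    then obtain u v w where uvw: "u \<noteq> v" "v \<noteq> w" "u \<noteq> w"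
      and N: "2 * herm q (V u) (V v) * (2 * herm q (V v) (V w)) * (2 * herm q (V w) (V u))
        + cj (2 * herm q (V u) (V v) * (2 * herm q (V v) (V w)) * (2 * herm q (V w) (V u))) = 0"
      using cyclic_product_trace_zero[OF cT _ anis] unfolding herm_V by metis
    let ?N = "herm q (V u) (V v) * herm q (V v) (V w) * herm q (V w) (V u)"
    have "2 * (2 * (2 * (?N + cj ?N))) = 0"
      using N unfolding cj_mult cj_2 by (simp add: algebra_simps)
    then have "?N + cj ?N = 0"
      using two_neq_0 by (metis mult_eq_0_iff)
    then have "\<not> nondegenerate_plane q (vec.span (vec.span {V u} \<union> vec.span {V v} \<union> vec.span {V w}))"
      using isotropic noncoll uvw by (intro gram_degenerate) auto
    moreover have "vec.span {V u} \<noteq> vec.span {V v}" "vec.span {V u} \<noteq> vec.span {V w}"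
        "vec.span {V v} \<noteq> vec.span {V w}"
      using V_inj uvw by blast+
    ultimately show False
      using nondeg V_S by simp
  qed
  then show ?thesis
    using graph_equivalent_veronesean[OF f _ _ _ S_eq] c anis by (simp add: T_def)
qed

end

theorem theorem1p2:
  fixes q :: nat
    and S :: "('a::{field,finite} ^ 4) set set"
    and P l :: "('a ^ 4) set"
  assumes q: "primepow q" "odd q"
    and card_field: "CARD('a) = q\<^sup>2"
    and S: "S \<subseteq> herm_surface q" "card S = q\<^sup>2 + 1" "pairwise_noncollinear q S"
    and i: "P \<in> S" "totally_isotropic_line q l" "P \<subseteq> l"
      "\<forall>Y \<in> herm_surface q. Y \<subseteq> l \<and> Y \<noteq> P \<longrightarrow> (\<exists>!Z. Z \<in> S - {P} \<and> herm_collinear q Y Z)"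
    and ii: "\<forall>b. baer_subline q l b \<and> P \<in> b \<longrightarrow>
      card (corr q S P ` b) = q + 1 \<and>
      (\<exists>E. is_plane E \<and> P \<subseteq> E \<and> (\<forall>R \<in> corr q S P ` b. R \<subseteq> E))"
    and iii: "\<exists>Q \<in> S. Q \<noteq> P \<and> (\<forall>R \<in> S. R \<noteq> P \<and> R \<noteq> Q \<longrightarrow> in_perspective q P Q R)"
    and iv: "\<forall>R1 \<in> S. \<forall>R2 \<in> S. \<forall>R3 \<in> S. R1 \<noteq> R2 \<and> R1 \<noteq> R3 \<and> R2 \<noteq> R3 \<longrightarrow>
      nondegenerate_plane q (vec.span (R1 \<union> R2 \<union> R3))"
  shows "herm_equivalent q S (herm_veronesean q)"
proof -
  interpret conjugation_field q "\<lambda>x::'a. x ^ q"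
    using q card_field by unfold_locales simp_all
  obtain Q where Q: "Q \<in> S" "Q \<noteq> P"
    and persp: "\<forall>R \<in> S. R \<noteq> P \<and> R \<noteq> Q \<longrightarrow> in_perspective q P Q R"
    using iii by blast
  have "\<not> herm_collinear q Q P"
    using S(3) Q i(1) by (auto simp: pairwise_noncollinear_def pairwise_def)
  then obtain e0 e1 e2 e3 where frame: "hyperbolic_frame q (\<lambda>x. x ^ q) e0 e1 e2 e3"
    and eqs: "P = vec.span {e3}" "Q = vec.span {e0}" "l = vec.span {e2, e3}"
    using obtain_hyperbolic_frame[of P Q l] S(1) Q(1) i(1-3) by blast
  show ?thesis
  proof (rule hyperbolic_frame.equivalent_veronesean[OF frame S(1,3)])
    show "\<forall>b. baer_subline q (vec.span {e2, e3}) b \<and> vec.span {e3} \<in> b \<longrightarrow>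
      (\<exists>E. is_plane E \<and> vec.span {e3} \<subseteq> E \<and> (\<forall>R \<in> corr q S (vec.span {e3}) ` b. R \<subseteq> E))"
      using ii unfolding eqs by blast
  qed (use i(1,4) Q(1) persp iv in \<open>simp_all add: eqs\<close>)
qed

end
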